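(* Let $z>0$ be a real number and let $F(1,1,z)$ be the free energy of the monopole-dimer model on the square grid with all edge weights equal to $1$ and all vertex weights equal to $z$. Then $$F(1,1,z)=\frac12\ln(4+z^2)-\frac{1}{(4+z^2)^2}\;{}_4F_3\!\left[\begin{matrix}1,\,1,\,\tfrac32,\,\tfrac32\\ 2,\,2,\,2\end{matrix};\frac{16}{(4+z^2)^2}\right].$$
   Context: ${}_4F_3$ denotes the generalized hypergeometric series: ${}_4F_3\left[\begin{matrix}\alpha_1,\dots,\alpha_4\\ \beta_1,\beta_2,\beta_3\end{matrix};u\right]=\sum_{i\ge0}\frac{(\alpha_1)_i\cdots(\alpha_4)_i}{(\beta_1)_i(\beta_2)_i(\beta_3)_i}\frac{u^i}{i!}$ with $(\alpha)_i=\alpha(\alpha+1)\cdots(\alpha+i-1)$. The free energy is $$F(a,b,z)=\lim_{\substack{m,n\to\infty\\ m,n\text{ even}}}\frac1{mn}\ln Z_{m,n},$$ where $Z_{m,n}$ is the partition function of the monopole-dimer model on the grid graph $Q_{m,n}$, defined as follows. Grid graph: $Q_{m,n}$ has vertex set $\{(i,j): 1\le i\le m,\ 1\le j\le n\}$ with its standard planar embedding as points of $\mathbb{Z}^2$. Edges $\{(i,j),(i,j+1)\}$ have weight $a$, edges $\{(i,j),(i+1,j)\}$ have weight $b$, and every vertex has weight $z$. Monopole-dimer configuration on a plane graph $G=[V,E]$: a collection $C$ of pairwise vertex-disjoint directed loops of even length in $G$, where a loop of length $2$ is a doubled edge (exactly one such loop for each edge) and a loop of length $2k\ge4$ is a directed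 simple cycle (so each undirected cycle gives two distinct directed loops). Every vertex is either isolated (a monopole) or belongs to exactly one loop. Weights: the weight of a loop $\ell$ is $w(\ell)=(-1)^{N(\ell)}$ times the product of the weights of the edges traversed by $\ell$ (for a doubled edge, the square of the edge weight), where $N(\ell)$ is the number of vertices of $V$ strictly enclosed by $\ell$. The weight $w(C)$ is the product of $w(\ell)$ over the loops $\ell$ of $C$ and of the vertex weights over the isolated vertices of $C$. The partition function is $Z=\sum_C w(C)$, summed over all monopole-dimer configurations. *)

theory Defs
  imports "HOL-Analysis.Analysis"
begin

section \<open>Monopole-dimer configurations on a plane graph\<close>

text \<open>
  A graph is given by its vertex set \<open>V\<close> and its set \<open>E\<close> of two-element edges; it is drawn in the
  complex plane by placing the vertices with \<open>pos\<close> and joining adjacent ones by straight segments.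

  A directed loop is represented by its set of arcs \<open>(u, v)\<close>. For a vertex list of length 2 this
  set is \<open>{(u, v), (v, u)}\<close>, so that each edge has exactly one doubled edge; for a longer list the
  set determines the cyclic order and the direction, and the two directions give different sets.
\<close>

definition directed_loop :: "'v set set \<Rightarrow> ('v \<times> 'v) set \<Rightarrow> bool" where
  "directed_loop E L \<longleftrightarrow>
     (\<exists>vs. distinct vs \<and> 2 \<le> length vs \<and> even (length vs) \<and>
           L = set (zip vs (rotate1 vs)) \<and> (\<forall>(u, v)\<in>L. {u, v} \<in> E))"

definition loop_verts :: "('v \<times> 'v) set \<Rightarrow> 'v set" where
  "loop_verts L = fst ` L"

definition loop_curve :: "('v \<Rightarrow> complex) \<Rightarrow> ('v \<times> 'v) set \<Rightarrow> complex set" where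
  "loop_curve pos L = (\<Union>(u, v)\<in>L. closed_segment (pos u) (pos v))"

definition enclosed_verts :: "'v set \<Rightarrow> ('v \<Rightarrow> complex) \<Rightarrow> ('v \<times> 'v) set \<Rightarrow> 'v set" where
  "enclosed_verts V pos L = {v \<in> V. pos v \<in> inside (loop_curve pos L)}"

text \<open>For a doubled edge the product over the two arcs is the square of the edge weight.\<close>

definition loop_weight ::
    "'v set \<Rightarrow> ('v \<Rightarrow> complex) \<Rightarrow> ('v set \<Rightarrow> real) \<Rightarrow> ('v \<times> 'v) set \<Rightarrow> real" where
  "loop_weight V pos ew L = (-1) ^ card (enclosed_verts V pos L) * (\<Prod>(u, v)\<in>L. ew {u, v})"

definition md_config :: "'v set set \<Rightarrow> ('v \<times> 'v) set set \<Rightarrow> bool" where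
  "md_config E C \<longleftrightarrow>
     (\<forall>L\<in>C. directed_loop E L) \<and> pairwise (\<lambda>L M. disjnt (loop_verts L) (loop_verts M)) C"

definition config_weight ::
    "'v set \<Rightarrow> ('v \<Rightarrow> complex) \<Rightarrow> ('v set \<Rightarrow> real) \<Rightarrow> ('v \<Rightarrow> real) \<Rightarrow> ('v \<times> 'v) set set \<Rightarrow> real"
  where
  "config_weight V pos ew vw C =
     (\<Prod>L\<in>C. loop_weight V pos ew L) * (\<Prod>v\<in>V - (\<Union>L\<in>C. loop_verts L). vw v)"

definition md_partition_function ::
    "'v set \<Rightarrow> 'v set set \<Rightarrow> ('v \<Rightarrow> complex) \<Rightarrow> ('v set \<Rightarrow> real) \<Rightarrow> ('v \<Rightarrow> real) \<Rightarrow> real" where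
  "md_partition_function V E pos ew vw = (\<Sum>C | md_config E C. config_weight V pos ew vw C)"

lemma finite_md_configs:
  assumes "finite V" "\<Union>E \<subseteq> V"
  shows "finite {C. md_config E C}"
proof (rule finite_subset)
  show "{C. md_config E C} \<subseteq> Pow (Pow (V \<times> V))"
  proof (intro subsetI, unfold Pow_iff mem_Collect_eq, intro subsetI, unfold Pow_iff, intro subsetI)
    fix C L p
    assume "md_config E C" "L \<in> C" "p \<in> L"
    then have "{fst p, snd p} \<in> E"
      by (auto simp: md_config_def directed_loop_def case_prod_beta)
    then have "{fst p, snd p} \<subseteq> V"
      using assms(2) by (meson Union_upper subset_trans)
    then show "p \<in> V \<times> V"
      by (simp add: mem_Times_iff)
  qed
  show "finite (Pow (Pow (V \<times> V)))"
    using assms(1) by simp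
qed

section \<open>The grid graph\<close>

definition grid_verts :: "nat \<Rightarrow> nat \<Rightarrow> (nat \<times> nat) set" where
  "grid_verts m n = {1..m} \<times> {1..n}"

definition a_edges :: "nat \<Rightarrow> nat \<Rightarrow> (nat \<times> nat) set set" where
  "a_edges m n = {{(i, j), (i, j + 1)} | i j. (i, j) \<in> grid_verts m n \<and> (i, j + 1) \<in> grid_verts m n}"

definition b_edges :: "nat \<Rightarrow> nat \<Rightarrow> (nat \<times> nat) set set" where
  "b_edges m n = {{(i, j), (i + 1, j)} | i j. (i, j) \<in> grid_verts m n \<and> (i + 1, j) \<in> grid_verts m n}"

definition grid_pos :: "nat \<times> nat \<Rightarrow> complex" where
  "grid_pos v = Complex (real (fst v)) (real (snd v))"

definition grid_Z :: "nat \<Rightarrow> nat \<Rightarrow> real \<Rightarrow> real \<Rightarrow> real \<Rightarrow> real" where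
  "grid_Z m n a b z =
     md_partition_function (grid_verts m n) (a_edges m n \<union> b_edges m n) grid_pos
       (\<lambda>e. if e \<in> a_edges m n then a else b) (\<lambda>_. z)"

section \<open>The free energy\<close>

text \<open>The joint limit: both coordinates tend to infinity independently along the even numbers.\<close>

definition even_pairs_at_top :: "(nat \<times> nat) filter" where
  "even_pairs_at_top = inf (at_top \<times>\<^sub>F at_top) (principal {(m, n). even m \<and> even n})"

definition finite_free_energy :: "real \<Rightarrow> real \<Rightarrow> real \<Rightarrow> nat \<times> nat \<Rightarrow> real" where
  "finite_free_energy a b z = (\<lambda>(m, n). 1 / (real m * real n) * ln (grid_Z m n a b z))"

definition free_energy :: "real \<Rightarrow> real \<Rightarrow> real \<Rightarrow> real" where
  "free_energy a b z = Lim even_pairs_at_top (finite_free_energy a b z)"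

lemma even_pairs_at_top_neq_bot: "even_pairs_at_top \<noteq> bot"
proof
  assume "even_pairs_at_top = bot"
  then have "\<forall>\<^sub>F x in at_top \<times>\<^sub>F at_top. \<not> (case x of (m, n) \<Rightarrow> even (m::nat) \<and> even (n::nat))"
    by (simp add: even_pairs_at_top_def trivial_limit_def eventually_inf_principal
        case_prod_beta mem_Times_iff)
  then obtain P Q :: "nat \<Rightarrow> bool" where "eventually P at_top" "eventually Q at_top"
    and PQ: "\<And>m n::nat. P m \<Longrightarrow> Q n \<Longrightarrow> \<not> (even m \<and> even n)"
    by (auto simp: eventually_prod_filter)
  then obtain M N where "\<And>m. M \<le> m \<Longrightarrow> P m" "\<And>n. N \<le> n \<Longrightarrow> Q n"
    by (auto simp: eventually_at_top_linorder)
  then show False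
    using PQ[of "2 * M" "2 * N"] by simp
qed

section \<open>The generalized hypergeometric series\<close>

definition hypergeo :: "real list \<Rightarrow> real list \<Rightarrow> real \<Rightarrow> real" where
  "hypergeo as bs u = eval_fps (fps_hypergeo as bs 1) u"

lemma hypergeo_4F3:
  "hypergeo [a1, a2, a3, a4] [b1, b2, b3] u =
     (\<Sum>i. pochhammer a1 i * pochhammer a2 i * pochhammer a3 i * pochhammer a4 i /
          (pochhammer b1 i * pochhammer b2 i * pochhammer b3 i) * (u ^ i / fact i))"
  by (simp add: hypergeo_def eval_fps_def)

end

theory Submission
  imports Defs "HOL-Combinatorics.Combinatorics" "HOL-Number_Theory.Cong"
    "HOL-Real_Asymp.Real_Asymp" "Jordan_Normal_Form.Determinant"
begin

text \<open>
  The partition function is a determinant. Give the steps of the grid Kasteleyn signs: east \<open>-b\<close>,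
  west \<open>b\<close>, north \<open>(-1)^i a\<close> and south \<open>-(-1)^i a\<close> in column \<open>i\<close>, with \<open>z\<close> on the diagonal.
  Expanding the determinant into cycles, a cycle of even length contributes the product of its
  signed entries with the sign \<open>-1\<close>, and this has to equal the loop weight; so the product of the
  Kasteleyn signs along a loop must be \<open>-(-1)^N\<close>, where \<open>N\<close> counts the enclosed vertices. With the
  Jordan curve theorem, deciding for every unit cell whether it is inside, this is a form of
  Pick's theorem modulo 2, which comes down to the turning number of the loop being odd; the
  latter is proved modulo 2 by Hopf's secant argument.

  The Kasteleyn matrix \<open>K\<close> satisfies \<open>K K\<^sup>T = z\<^sup>2 - b\<^sup>2 A\<^sup>2 \<otimes> 1 - a\<^sup>2 1 \<otimes> A\<^sup>2\<close> for skew
  tridiagonal \<open>A\<close>, and is diagonalised by sines, whence \<open>Z\<^sup>2\<close> is the product of \<open>z\<^sup>2 + 4 b\<^sup>2 cos\<^sup>2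
  (\<pi> k / (m + 1)) + 4 a\<^sup>2 cos\<^sup>2 (\<pi> l / (n + 1))\<close>. For \<open>a = b = 1\<close> each factor is \<open>4 + z\<^sup>2\<close> plus
  two terms of modulus at most 2. Expanding the logarithm around \<open>4 + z\<^sup>2\<close>, the mean of the \<open>r\<close>-th
  powers tends to \<open>0\<close> for odd \<open>r\<close> and to \<open>(r choose r/2)\<^sup>2\<close> for even \<open>r\<close>, and Tannery's theorem
  gives the limit.
\<close>

section \<open>Turning parity of lattice cycles\<close>

text \<open>Pick's theorem modulo 2 is reduced to one bookkeeping device: each grid vertex stands
  for the unit cell to its north-east, with sign -1 if that cell is inside the loop. Over the whole
  grid these signs telescope along rows and leave the vertical loop edges in odd columns, which is
  what the column-dependent signs of vertical steps record. At a loop vertex, the choice of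
  north-east makes the sign depend on an eastward step out, a southward step in and the turn; this
  is where the signs of east and south steps originate. A vertex off the loop is inside exactly when
  its cell is, so the remaining product is \<open>(-1)^N\<close>. Hopf's argument usually follows a
  continuous angle. For integer secants, counting crossings of a ray between two lattice heights
  suffices, and every elementary move becomes a finite case check. Working with \<open>K K^T\<close>
  keeps all modes real but yields only \<open>Z^2\<close>; a separate deformation argument fixes the
  sign of \<open>Z\<close>.\<close>

definition unit_step :: "int \<Rightarrow> int \<Rightarrow> bool" where
  "unit_step a b \<longleftrightarrow> \<bar>a\<bar> + \<bar>b\<bar> = 1"

lemma unit_step_cases:
  assumes "unit_step a b"
  obtains "a = 1" "b = 0" | "a = -1" "b = 0" | "a = 0" "b = 1" | "a = 0" "b = -1"
  using assms unfolding unit_step_def by (smt (verit))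

text \<open>
  The rotation of a path of integer vectors is counted modulo 2, by its crossings with the ray
  \<open>{(t, -1/2) | t > 0}\<close>: among unit steps only those between heights \<open>-1\<close> and \<open>0\<close> can cross it.
\<close>

definition ray_cross :: "int \<times> int \<Rightarrow> int \<times> int \<Rightarrow> int" where
  "ray_cross p q =
     (if fst p > 0 \<and> fst q > 0 \<and> (snd p = -1 \<and> snd q = 0 \<or> snd p = 0 \<and> snd q = -1) then -1 else 1)"

text \<open>The end \<open>(0, -1/2)\<close> of the ray lies on an edge at the origin, so a unit
  square avoiding the origin is either missed or crossed through two opposite sides. Parallel steps
  give degenerate squares.\<close>

lemma ray_cross_square:
  assumes e: "unit_step e1 e2" and f: "unit_step f1 f2"
    and nz: "(a, b) \<noteq> (0, 0)" "(a + e1, b + e2) \<noteq> (0, 0)" "(a + f1, b + f2) \<noteq> (0, 0)"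
      "(a + e1 + f1, b + e2 + f2) \<noteq> (0, 0)"
  shows "ray_cross (a, b) (a + e1, b + e2) * ray_cross (a + e1, b + e2) (a + e1 + f1, b + e2 + f2) =
    ray_cross (a, b) (a + f1, b + f2) * ray_cross (a + f1, b + f2) (a + e1 + f1, b + e2 + f2)"
  by (rule unit_step_cases[OF e]; rule unit_step_cases[OF f])
     (use nz in \<open>auto simp: ray_cross_def\<close>)

lemma ray_cross_upper: "0 \<le> snd p \<Longrightarrow> 0 \<le> snd q \<Longrightarrow> ray_cross p q = 1"
  by (auto simp: ray_cross_def)

lemma ray_cross_lower:
  assumes "snd p < 0 \<or> snd p = 0 \<and> fst p \<le> 0" "snd q < 0 \<or> snd q = 0 \<and> fst q \<le> 0"
  shows "ray_cross p q = 1"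
  using assms by (auto simp: ray_cross_def)

text \<open>This is the source of the total sign -1 in \<open>turn_prod\<close>. At the leftmost of
  the lowest vertices, \<open>(a, b)\<close> leads to the next vertex and \<open>(c, d)\<close> to
  the previous one, so they are east and north in some order. The first two factors go around the
  vanishing secant of the closed cycle, the last two are the turn at that vertex.\<close>

lemma ray_cross_corner:
  assumes "unit_step a b" "unit_step c d" "(a, b) \<noteq> (c, d)"
    and "0 < b \<or> b = 0 \<and> 0 \<le> a" "0 < d \<or> d = 0 \<and> 0 \<le> c"
  shows "ray_cross (c, d) (c - a, d - b) * ray_cross (c - a, d - b) (- a, - b) *
    (ray_cross (- c, - d) (a - c, b - d) * ray_cross (a - c, b - d) (a, b)) = -1"
  by (rule unit_step_cases[OF assms(1)]; rule unit_step_cases[OF assms(2)])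
     (use assms(3-) in \<open>auto simp: ray_cross_def\<close>)

text \<open>Unrolled, \<open>e i\<close> occurs in \<open>t 0\<close>, ...,
  \<open>t (i - 1)\<close>, hence \<open>i\<close> times. This exponent becomes the column parity in
  \<open>vertical_sign\<close>.\<close>

lemma prod_telescope_weighted:
  fixes t e :: "nat \<Rightarrow> 'a::comm_monoid_mult"
  assumes "\<And>i. t i = e (Suc i) * t (Suc i)"
  shows "(\<Prod>i<m. t i) = t m ^ m * (\<Prod>i=1..m. e i ^ i)"
proof (induction m)
  case (Suc m)
  have "(\<Prod>i<Suc m. t i) = t m ^ Suc m * (\<Prod>i=1..m. e i ^ i)"
    using Suc by (simp add: mult_ac)
  also have "t m ^ Suc m = t (Suc m) ^ Suc m * e (Suc m) ^ Suc m"
    using assms[of m] by (simp add: power_mult_distrib mult_ac)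
  finally show ?case
    by (simp add: mult_ac)
qed simp

lemma prod_sign_card:
  fixes P :: "'b \<Rightarrow> bool"
  assumes "finite A"
  shows "(\<Prod>a\<in>A. if P a then -1 else 1 :: int) = (-1) ^ card {a \<in> A. P a}"
  using assms by (simp add: prod.If_cases Int_def)

lemma prod_shift_period:
  fixes f :: "nat \<Rightarrow> 'a::comm_monoid_mult"
  assumes "\<And>k. f (k + n) = f k"
  shows "(\<Prod>k<n. f (k + r)) = (\<Prod>k<n. f k)"
proof (induction r)
  case (Suc r)
  show ?case
  proof (cases n)
    case (Suc m)
    have "(\<Prod>k<n. f (k + Suc r)) = (\<Prod>k<m. f (Suc k + r)) * f (n + r)"
      unfolding Suc by (simp add: add.commute)
    also have "f (n + r) = f (0 + r)"
      using assms[of r] by (simp add: add.commute)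
    also have "(\<Prod>k<m. f (Suc k + r)) * f (0 + r) = (\<Prod>k<n. f (k + r))"
      unfolding Suc prod.lessThan_Suc_shift by (simp add: mult.commute)
    finally show ?thesis
      using Suc.IH by simp
  qed simp
qed simp

text \<open>Vertices are indexed by all naturals with period \<open>n\<close>, so
  \<open>same_vertex_iff\<close> expresses closedness and simplicity at once and secants may run
  past the end of the cycle.\<close>

locale lattice_cycle =
  fixes x y :: "nat \<Rightarrow> int" and n :: nat
  assumes n_ge_3: "3 \<le> n"
    and step: "unit_step (x (Suc k) - x k) (y (Suc k) - y k)"
    and same_vertex_iff: "(x i, y i) = (x j, y j) \<longleftrightarrow> i mod n = j mod n"
begin

lemma period: "x (k + n) = x k" "y (k + n) = y k"
  using same_vertex_iff[of "k + n" k] by auto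

lemma simple: "i < j \<Longrightarrow> j < n + i \<Longrightarrow> (x j, y j) \<noteq> (x i, y i)"
  using same_vertex_iff[of j i] mod_eq_dvd_iff_nat[of i j n] nat_dvd_not_less[of "j - i" n] by auto

lemma same_vertex_Suc_iff: "(x (Suc i), y (Suc i)) = (x (Suc j), y (Suc j)) \<longleftrightarrow> (x i, y i) = (x j,
  y j)"
proof -
  have "Suc i mod n = Suc j mod n \<longleftrightarrow> i mod n = j mod n"
    using cong_add_rcancel_nat[of i 1 j n] by (simp add: cong_def)
  then show ?thesis
    using same_vertex_iff by metis
qed

text \<open>
  Hopf's argument: the secants \<open>secant i j\<close> with \<open>i < j < n + i\<close> do not vanish, so the crossing
  parity of a staircase path in this triangle depends only on its ends. Along the diagonal the
  secant rotates with the direction of the cycle; along the two legs, seen from a lowest vertex,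
  it stays in a half-plane.
\<close>

definition secant :: "nat \<Rightarrow> nat \<Rightarrow> int \<times> int" where
  "secant i j = (x j - x i, y j - y i)"

definition head_cross :: "nat \<Rightarrow> nat \<Rightarrow> int" where
  "head_cross i j = ray_cross (secant i j) (secant i (Suc j))"

definition tail_cross :: "nat \<Rightarrow> nat \<Rightarrow> int" where
  "tail_cross i j = ray_cross (secant i j) (secant (Suc i) j)"

text \<open>\<open>turn k = -1\<close> iff the corner at vertex \<open>Suc k\<close> is formed by an eastward and a southward step.\<close>

definition turn :: "nat \<Rightarrow> int" where
  "turn k = head_cross k (Suc k) * tail_cross k (Suc (Suc k))"

text \<open>The bounds keep all four secants nonzero. Advancing the tail moves the secant by the
  reversed step, hence the step \<open>u\<close> in the proof.\<close>

lemma cross_square: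
  assumes "Suc i < j" "Suc j < n + i"
  shows "head_cross i j * tail_cross i (Suc j) = tail_cross i j * head_cross (Suc i) j"
proof -
  have u: "unit_step (x i - x (Suc i)) (y i - y (Suc i))"
    using step[of i] by (simp add: unit_step_def abs_minus_commute)
  have nz: "secant i j \<noteq> (0,0)" "secant i (Suc j) \<noteq> (0,0)" "secant (Suc i) j \<noteq> (0,0)"
      "secant (Suc i) (Suc j) \<noteq> (0,0)"
    using simple[of i j] simple[of i "Suc j"] simple[of "Suc i" j] simple[of "Suc i" "Suc j"] assms
    by (auto simp: secant_def)
  show ?thesis
    using ray_cross_square[OF step[of j] u, of "x j - x i" "y j - y i"] nz
    by (simp add: head_cross_def tail_cross_def secant_def)
qed

text \<open>A head step is pushed through a run of tail steps, one \<open>cross_square\<close> at a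
  time.\<close>

lemma cross_column:
  assumes "s \<le> a" "a < j" "Suc j < n + s"
  shows "(\<Prod>i=s..<a. tail_cross i j) * head_cross a j = head_cross s j *
    (\<Prod>i=s..<a. tail_cross i (Suc j))"
  using assms
proof (induction a rule: dec_induct)
  case (step a)
  have "(\<Prod>i=s..<Suc a. tail_cross i j) * head_cross (Suc a) j
      = (\<Prod>i=s..<a. tail_cross i j) * (tail_cross a j * head_cross (Suc a) j)"
    using step.hyps by (simp add: mult.assoc)
  also have "tail_cross a j * head_cross (Suc a) j = head_cross a j * tail_cross a (Suc j)"
    using cross_square[of a j] step by simp
  also have "(\<Prod>i=s..<a. tail_cross i j) * (head_cross a j * tail_cross a (Suc j))
      = head_cross s j * (\<Prod>i=s..<a. tail_cross i (Suc j)) * tail_cross a (Suc j)"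
    using step by simp
  finally show ?case
    using step.hyps by (simp add: mult.assoc)
qed simp

text \<open>Straightens the staircase along the diagonal into two legs. The bound
  \<open>j + 2 \<le> n\<close> stops short of the secant from 0 to \<open>n\<close>, which
  vanishes.\<close>

lemma cross_diagonal:
  assumes "j + 2 \<le> n"
  shows "(\<Prod>k<j. turn k) = (\<Prod>l=1..<Suc j. head_cross 0 l) * (\<Prod>i=0..<j. tail_cross i (Suc j))"
  using assms
proof (induction j)
  case (Suc j)
  have "(\<Prod>k<Suc j. turn k) = (\<Prod>l=1..<Suc j. head_cross 0 l) *
      ((\<Prod>i=0..<j. tail_cross i (Suc j)) * head_cross j (Suc j)) * tail_cross j (Suc (Suc j))"
    using Suc by (simp add: turn_def)
  also have "(\<Prod>i=0..<j. tail_cross i (Suc j)) * head_cross j (Suc j) =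
      head_cross 0 (Suc j) * (\<Prod>i=0..<j. tail_cross i (Suc (Suc j)))"
    by (rule cross_column) (use Suc.prems in auto)
  finally show ?case
    by (simp add: mult_ac)
qed simp

lemma turn_prod:
  assumes min: "\<And>k. y 0 < y k \<or> y 0 = y k \<and> x 0 \<le> x k"
  shows "(\<Prod>k<n. turn k) = -1"
proof -
  \<comment> \<open>With \<open>n = q + 3\<close>, the vertices \<open>q + 3\<close> and
    \<open>q + 4\<close> are the vertices 0 and 1 again.\<close>
  define q where "q = n - 3"
  have n: "n = q + 3"
    using n_ge_3 by (simp add: q_def)
  have q: "q + 3 = 0 + n" "q + 4 = 1 + n"
    by (simp_all add: n)
  have end0: "x (q + 3) = x 0" "y (q + 3) = y 0" "x (q + 4) = x 1" "y (q + 4) = y 1"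
    unfolding q by (rule period)+
  have min_y: "y 0 \<le> y k" for k
    using min[of k] by (elim disjE) simp_all
  have below: "snd (x 0 - x k, y 0 - y k) < 0 \<or>
      snd (x 0 - x k, y 0 - y k) = 0 \<and> fst (x 0 - x k, y 0 - y k) \<le> 0" for k
    using min[of k] by (elim disjE) simp_all
  have H: "head_cross 0 l = 1" for l
    unfolding head_cross_def secant_def
    by (rule ray_cross_upper) (use min_y in simp_all)
  have W: "tail_cross i (q + 3) = 1" for i
    unfolding tail_cross_def secant_def end0
    by (rule ray_cross_lower) (rule below)+
  have "(\<Prod>k<n. turn k) = (\<Prod>k<Suc q. turn k) * turn (q + 1) * turn (q + 2)"
    by (simp add: n eval_nat_numeral)
  also have "(\<Prod>k<Suc q. turn k) = (\<Prod>i=0..<Suc q. tail_cross i (q + 2))"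
    by (subst cross_diagonal) (simp_all add: n H)
  also have "\<dots> = tail_cross 0 (q + 2) * (\<Prod>i=1..<Suc q. tail_cross i (q + 2))"
    by (subst prod.atLeast_Suc_lessThan) auto
  also have "turn (q + 1) = head_cross (q + 1) (q + 2) * tail_cross (q + 1) (q + 3)"
    by (simp add: turn_def eval_nat_numeral)
  also have "tail_cross 0 (q + 2) * (\<Prod>i=1..<Suc q. tail_cross i (q + 2)) *
        (head_cross (q + 1) (q + 2) * tail_cross (q + 1) (q + 3)) =
      tail_cross 0 (q + 2) * ((\<Prod>i=1..<Suc q. tail_cross i (q + 2)) * head_cross (Suc q) (q + 2))"
    by (simp add: W)
  \<comment> \<open>The run is moved to head \<open>q + 3\<close> only from tail 1 on, since the
    secant from 0 to \<open>q + 3\<close> is zero; the tail step from 0 is kept for the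
    corner.\<close>
  also have "(\<Prod>i=1..<Suc q. tail_cross i (q + 2)) * head_cross (Suc q) (q + 2) =
      head_cross 1 (q + 2) * (\<Prod>i=1..<Suc q. tail_cross i (Suc (q + 2)))"
    by (rule cross_column) (auto simp: n)
  also have "(\<Prod>i=1..<Suc q. tail_cross i (Suc (q + 2))) = 1"
    using W by (intro prod.neutral) (simp add: eval_nat_numeral)
  also have "turn (q + 2) = head_cross (q + 2) (q + 3) * tail_cross (q + 2) (q + 4)"
    by (simp add: turn_def eval_nat_numeral)
  also have "tail_cross 0 (q + 2) * (head_cross 1 (q + 2) * 1) *
      (head_cross (q + 2) (q + 3) * tail_cross (q + 2) (q + 4)) = -1"
  proof -
    have u: "unit_step (x 1 - x 0) (y 1 - y 0)" "unit_step (x 0 - x (q + 2)) (y 0 - y (q + 2))"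
      using step[of 0] step[of "q + 2"] end0 by (simp_all add: eval_nat_numeral)
    have ne: "(x 1, y 1) \<noteq> (x (q + 2), y (q + 2))"
      using simple[of 1 "q + 2"] n by auto
    define a b c d where "a = x 1 - x 0" and "b = y 1 - y 0"
      and "c = x (q + 2) - x 0" and "d = y (q + 2) - y 0"
    have "ray_cross (c, d) (c - a, d - b) * ray_cross (c - a, d - b) (- a, - b) *
      (ray_cross (- c, - d) (a - c, b - d) * ray_cross (a - c, b - d) (a, b)) = -1"
    proof (rule ray_cross_corner)
      show "unit_step a b" "unit_step c d"
        using u by (simp_all add: a_def b_def c_def d_def unit_step_def abs_minus_commute)
      show "(a, b) \<noteq> (c, d)"
        using ne by (auto simp: a_def b_def c_def d_def)
      show "0 < b \<or> b = 0 \<and> 0 \<le> a" "0 < d \<or> d = 0 \<and> 0 \<le> c"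
        using min[of 1] min[of "q + 2"] unfolding a_def b_def c_def d_def
        by (elim disjE, simp_all)+
    qed
    moreover have "c - a = x (q + 2) - x 1" "d - b = y (q + 2) - y 1"
      "- a = x 0 - x 1" "- b = y 0 - y 1" "- c = x 0 - x (q + 2)" "- d = y 0 - y (q + 2)"
      "a - c = x 1 - x (q + 2)" "b - d = y 1 - y (q + 2)"
      by (simp_all add: a_def b_def c_def d_def)
    moreover have "Suc 0 = 1" "Suc (q + 2) = q + 3" "Suc (q + 3) = q + 4"
      by simp_all
    ultimately show ?thesis
      unfolding tail_cross_def head_cross_def secant_def end0 a_def b_def c_def d_def mult_1_right
      by (simp only: end0)
  qed
  finally show ?thesis .
qed

text \<open>The Kasteleyn sign of a step is split in three because the parts are evaluated
  differently: \<open>east_sign\<close> and \<open>south_sign\<close> through the cells at the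
  vertices of the cycle, \<open>vertical_sign\<close> through whole rows of cells.\<close>

definition east_sign :: "nat \<Rightarrow> int" where
  "east_sign k = (if x (Suc k) = x k + 1 then -1 else 1)"

definition south_sign :: "nat \<Rightarrow> int" where
  "south_sign k = (if y (Suc k) = y k - 1 then -1 else 1)"

definition vertical_sign :: "nat \<Rightarrow> int" where
  "vertical_sign k = (if x (Suc k) = x k \<and> odd (x k) then -1 else 1)"

definition edge :: "int \<times> int \<Rightarrow> int \<times> int \<Rightarrow> bool" where
  "edge p q \<longleftrightarrow> (\<exists>k. {p, q} = {(x k, y k), (x (Suc k), y (Suc k))})"

lemma edge_sym: "edge p q \<longleftrightarrow> edge q p"
  by (simp add: edge_def insert_commute)

lemma edge_at_vertex:
  "edge (x (Suc k), y (Suc k)) w \<longleftrightarrow> w = (x k, y k) \<or> w = (x (Suc (Suc k)), y (Suc (Suc k)))"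
proof
  assume "edge (x (Suc k), y (Suc k)) w"
  then obtain l where l: "{(x (Suc k), y (Suc k)), w} = {(x l, y l), (x (Suc l), y (Suc l))}"
    by (auto simp: edge_def)
  then consider "(x (Suc k), y (Suc k)) = (x l, y l)" "w = (x (Suc l), y (Suc l))"
    | "(x (Suc k), y (Suc k)) = (x (Suc l), y (Suc l))" "w = (x l, y l)"
    unfolding doubleton_eq_iff by blast
  then show "w = (x k, y k) \<or> w = (x (Suc (Suc k)), y (Suc (Suc k)))"
    by cases (metis same_vertex_Suc_iff)+
qed (auto simp: edge_def insert_commute)

end

text \<open>An abstract inside indicator: \<open>s i j\<close> belongs to the unit cell with
  south-west corner \<open>(i, j)\<close> and changes exactly across edges of the cycle. This
  isolates the parity count from topology; \<open>cell_sign\<close> instantiates it later.\<close>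

locale lattice_cycle_cells = lattice_cycle +
  fixes s :: "int \<Rightarrow> int \<Rightarrow> int"
  assumes s_pm: "s i j = 1 \<or> s i j = -1"
    and flip_vertical: "s (i - 1) j = (if edge (i, j) (i, j + 1) then - s i j else s i j)"
    and flip_horizontal: "s i (j - 1) = (if edge (i, j) (i + 1, j) then - s i j else s i j)"
    and even_n: "even n"
    and lowest: "\<And>k. y 0 < y k \<or> y 0 = y k \<and> x 0 \<le> x k"
begin

definition left_sign :: "nat \<Rightarrow> int" where
  "left_sign k =
     (if x (Suc k) = x k + 1 then s (x k) (y k)
      else if y (Suc k) = y k + 1 then s (x k - 1) (y k)
      else if x (Suc k) = x k - 1 then s (x k - 1) (y k - 1)
      else s (x k) (y k - 1))"

text \<open>
  The value of \<open>s\<close> on the left of the cycle is constant, and the bracketed sign is \<open>-1\<close> iff the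
  cell north-east of the vertex lies on the left.
\<close>

lemma corner_cell_sign:
  "left_sign (Suc k) = left_sign k"
  "s (x (Suc k)) (y (Suc k)) = - left_sign k * (east_sign (Suc k) * south_sign k * turn k)"
proof -
  define X where "X = x (Suc k)"
  define Y where "Y = y (Suc k)"
  have ne: "(x k, y k) \<noteq> (x (Suc (Suc k)), y (Suc (Suc k)))"
    using simple[of k "Suc (Suc k)"] n_ge_3 by auto
  have ed: "edge (X, Y) w \<longleftrightarrow> w = (x k, y k) \<or> w = (x (Suc (Suc k)), y (Suc (Suc k)))" for w
    using edge_at_vertex by (simp add: X_def Y_def)
  have f: "s (X - 1) Y = (if edge (X, Y) (X, Y + 1) then - s X Y else s X Y)"
    "s X (Y - 1) = (if edge (X, Y) (X + 1, Y) then - s X Y else s X Y)"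
    "s (X - 1) (Y - 1) = (if edge (X, Y) (X, Y - 1) then - s X (Y - 1) else s X (Y - 1))"
    using flip_vertical[of X Y] flip_horizontal[of X Y] flip_vertical[of X "Y - 1"]
    by (simp_all add: edge_sym[of "(X, Y)" "(X, Y - 1)"])
  have u: "unit_step (X - x k) (Y - y k)" "unit_step (x (Suc (Suc k)) - X) (y (Suc (Suc k)) - Y)"
    using step[of k] step[of "Suc k"] by (simp_all add: X_def Y_def)
  define e1 e2 f1 f2 where "e1 = X - x k" and "e2 = Y - y k"
    and "f1 = x (Suc (Suc k)) - X" and "f2 = y (Suc (Suc k)) - Y"
  have nb: "x k = X - e1" "y k = Y - e2" "x (Suc (Suc k)) = X + f1" "y (Suc (Suc k)) = Y + f2"
    by (simp_all add: e1_def e2_def f1_def f2_def)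
  have u': "unit_step e1 e2" "unit_step f1 f2"
    using u by (simp_all add: e1_def e2_def f1_def f2_def)
  have ne': "\<not> (e1 = - f1 \<and> e2 = - f2)"
    using ne nb by auto
  have edges: "edge (X, Y) (X, Y + 1) \<longleftrightarrow> e1 = 0 \<and> e2 = -1 \<or> f1 = 0 \<and> f2 = 1"
    "edge (X, Y) (X + 1, Y) \<longleftrightarrow> e1 = -1 \<and> e2 = 0 \<or> f1 = 1 \<and> f2 = 0"
    "edge (X, Y) (X, Y - 1) \<longleftrightarrow> e1 = 0 \<and> e2 = 1 \<or> f1 = 0 \<and> f2 = -1"
    unfolding ed nb by auto
  have left: "left_sign k = (if e1 = 1 then s (X - 1) Y else if e2 = 1 then s (X - 1) (Y - 1)
      else if e1 = -1 then s X (Y - 1) else s X Y)"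
    by (rule unit_step_cases[OF u'(1)]) (simp_all add: left_sign_def nb flip: X_def Y_def)
  have left': "left_sign (Suc k) = (if f1 = 1 then s X Y else if f2 = 1 then s (X - 1) Y
      else if f1 = -1 then s (X - 1) (Y - 1) else s X (Y - 1))"
    by (rule unit_step_cases[OF u'(2)]) (simp_all add: left_sign_def nb flip: X_def Y_def)
  have signs: "east_sign (Suc k) = (if f1 = 1 then -1 else 1)"
    "south_sign k = (if e2 = -1 then -1 else 1)"
    by (auto simp: east_sign_def south_sign_def nb simp flip: X_def Y_def)
  have turn: "turn k = ray_cross (e1, e2) (e1 + f1, e2 + f2) * ray_cross (e1 + f1, e2 + f2) (f1,
    f2)"
    by (simp add: turn_def head_cross_def tail_cross_def secant_def nb add.commute flip: X_def
      Y_def)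
  have "left_sign (Suc k) = left_sign k \<and>
    s (x (Suc k)) (y (Suc k)) = - left_sign k * (east_sign (Suc k) * south_sign k * turn k)"
    unfolding left left' signs turn X_def[symmetric] Y_def[symmetric] f edges
    by (rule unit_step_cases[OF u'(1)]; rule unit_step_cases[OF u'(2)];
        insert ne'; simp add: ray_cross_def)
  then show "left_sign (Suc k) = left_sign k"
    "s (x (Suc k)) (y (Suc k)) = - left_sign k * (east_sign (Suc k) * south_sign k * turn k)"
    by blast+
qed

text \<open>As \<open>n\<close> is even, the constant \<open>left_sign\<close> cancels for both
  orientations, and the minus sign is that of \<open>turn_prod\<close>. Shifting by one vertex
  aligns the outgoing \<open>east_sign\<close> with the incoming \<open>south_sign\<close>.\<close>

lemma vertex_cells_prod:
  "(\<Prod>k<n. s (x k) (y k)) = - (\<Prod>k<n. east_sign k * south_sign k)"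
proof -
  have left: "left_sign k = left_sign 0" for k
    by (induction k) (simp_all add: corner_cell_sign)
  have left1: "left_sign 0 = 1 \<or> left_sign 0 = -1"
    using s_pm by (auto simp: left_sign_def)
  have "(\<Prod>k<n. s (x k) (y k)) = (\<Prod>k<n. s (x (k + 1)) (y (k + 1)))"
    by (rule prod_shift_period[symmetric]) (simp add: period)
  also have "\<dots> = (\<Prod>k<n. - left_sign 0 * (east_sign (k + 1) * south_sign k * turn k))"
    using corner_cell_sign left by (intro prod.cong) auto
  also have "\<dots> = (- left_sign 0) ^ n * ((\<Prod>k<n. east_sign (k + 1)) * (\<Prod>k<n. south_sign k) *
    (\<Prod>k<n. turn k))"
    by (simp only: prod.distrib prod_constant card_lessThan)
  also have "(- left_sign 0) ^ n = 1"
    using left1 even_n by auto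
  also have "(\<Prod>k<n. east_sign (k + 1)) = (\<Prod>k<n. east_sign k)"
    using period by (intro prod_shift_period) (simp add: east_sign_def flip: add_Suc)
  also have "(\<Prod>k<n. turn k) = -1"
    by (rule turn_prod) (rule lowest)
  finally show ?thesis
    by (simp add: prod.distrib)
qed

text \<open>A vertical step is identified by the lower end of its edge. Only a step and its reversal
  could collide, and a simple cycle with \<open>n \<ge> 3\<close> never retraces an edge.\<close>

lemma card_odd_vertical_edges:
  assumes bounds: "\<And>k. 1 \<le> x k \<and> x k \<le> int m \<and> 1 \<le> y k \<and> y k \<le> int w"
  shows "card {k \<in> {..<n}. x (Suc k) = x k \<and> odd (x k)} =
    card {p \<in> {1..m} \<times> {1..w}. edge (int (fst p), int (snd p)) (int (fst p), int (snd p) +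
      1) \<and> odd (fst p)}"
    (is "card ?K = card ?D")
proof (rule bij_betw_same_card)
  let ?f = "\<lambda>k. (nat (x k), nat (min (y k) (y (Suc k))))"
  have st: "y (Suc k) = y k + 1 \<or> y (Suc k) = y k - 1" if "x (Suc k) = x k" for k
    using step[of k] that by (auto simp: unit_step_def)
  have nonneg: "0 \<le> x k" "0 \<le> y k" for k
    using bounds[of k] by simp_all
  have "inj_on ?f ?K"
  proof (rule inj_onI)
    fix k l assume k: "k \<in> ?K" and l: "l \<in> ?K" and eq: "?f k = ?f l"
    have X: "x k = x l" and Y: "min (y k) (y (Suc k)) = min (y l) (y (Suc l))"
      using eq nonneg by (simp_all add: nat_eq_iff2)
    consider "y k = y l" | "y k = y (Suc l)" "y (Suc k) = y l"
      using st[of k] st[of l] Y k l by force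
    then show "k = l"
    proof cases
      case 1
      then show ?thesis
        using X same_vertex_iff[of k l] k l by simp
    next
      case 2
      then have "(x (Suc k), y (Suc k)) = (x l, y l)" "(x k, y k) = (x (Suc l), y (Suc l))"
        using X k l by simp_all
      then have "(x (Suc (Suc k)), y (Suc (Suc k))) = (x k, y k)"
        using same_vertex_Suc_iff[of "Suc k" l] by simp
      then show ?thesis
        using simple[of k "Suc (Suc k)"] n_ge_3 by simp
    qed
  qed
  moreover have "?f ` ?K = ?D"
  proof (intro equalityI subsetI)
    fix p assume "p \<in> ?f ` ?K"
    then obtain k where k: "k \<in> ?K" and p: "p = ?f k"
      by blast
    have "edge (x k, min (y k) (y (Suc k))) (x k, min (y k) (y (Suc k)) + 1)"
      using st[of k] k unfolding edge_def by (intro exI[of _ k]) (auto simp: min_def)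
    then show "p \<in> ?D"
      using k bounds[of k] bounds[of "Suc k"] nonneg[of k] nonneg[of "Suc k"]
      by (auto simp: p min_def even_nat_iff split: if_splits)
  next
    fix p assume p: "p \<in> ?D"
    obtain i j where ij: "p = (i, j)"
      by fastforce
    from p obtain l where l: "{(int i, int j), (int i, int j + 1)} = {(x l, y l), (x (Suc l),
      y (Suc l))}"
      by (auto simp: ij edge_def)
    define k where "k = l mod n"
    have kl: "(x k, y k) = (x l, y l)"
      by (simp add: same_vertex_iff k_def del: prod.inject)
    moreover from kl have "(x (Suc k), y (Suc k)) = (x (Suc l), y (Suc l))"
      by (simp only: same_vertex_Suc_iff)
    ultimately have k: "{(int i, int j), (int i, int j + 1)} = {(x k, y k), (x (Suc k), y (Suc k))}"
      using l by simp
    have "k < n"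
      using n_ge_3 by (simp add: k_def)
    moreover have "x k = int i" "x (Suc k) = int i" "min (y k) (y (Suc k)) = int j"
      using k unfolding doubleton_eq_iff by auto
    ultimately show "p \<in> ?f ` ?K"
      using p by (intro image_eqI[of _ _ k]) (auto simp: ij)
  qed
  ultimately show "bij_betw ?f ?K ?D"
    by (simp add: bij_betw_def)
qed

text \<open>A vertical edge in column \<open>i\<close> flips the sign of the \<open>i\<close> cells to its left in its row.\<close>

lemma all_cells_prod:
  assumes bounds: "\<And>k. 1 \<le> x k \<and> x k \<le> int m \<and> 1 \<le> y k \<and> y k \<le> int w"
    and outer: "\<And>i j. i \<le> 0 \<or> int m \<le> i \<Longrightarrow> s i j = 1"
  shows "(\<Prod>p\<in>{1..m} \<times> {1..w}. s (int (fst p)) (int (snd p))) = (\<Prod>k<n. vertical_sign k)"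
proof -
  define e where "e i j = (if edge (int i, int j) (int i, int j +
    1) then -1 else 1 :: int)" for i j :: nat
  have m: "1 \<le> m"
    using bounds[of 0] by linarith
  have row: "(\<Prod>i\<in>{1..m}. s (int i) (int j)) = (\<Prod>i\<in>{1..m}. e i j ^ i)" for j
  proof -
    have "s (int i) (int j) = e (Suc i) j * s (int (Suc i)) (int j)" for i
      using flip_vertical[of "int (Suc i)" "int j"] by (simp add: e_def)
    then have "(\<Prod>i<m. s (int i) (int j)) = s (int m) (int j) ^ m * (\<Prod>i=1..m. e i j ^ i)"
      by (rule prod_telescope_weighted)
    also have "s (int m) (int j) = 1"
      by (simp add: outer)
    \<comment> \<open>Columns 0 and \<open>m\<close> consist of outer cells with sign 1, so the
      telescoped range \<open>i < m\<close> can be exchanged for \<open>1..m\<close>.\<close>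
    also have "(\<Prod>i<m. s (int i) (int j)) = (\<Prod>i\<in>{1..<m}. s (int i) (int j))"
      using m by (simp add: lessThan_atLeast0 prod.atLeast_Suc_lessThan outer)
    also have "\<dots> = (\<Prod>i\<in>{1..m}. s (int i) (int j))"
      using m by (simp add: atLeastLessThanSuc_atLeastAtMost[symmetric] outer)
    finally show ?thesis
      by simp
  qed
  have "(\<Prod>p\<in>{1..m} \<times> {1..w}. s (int (fst p)) (int (snd p))) =
      (\<Prod>j\<in>{1..w}. \<Prod>i\<in>{1..m}. s (int i) (int j))"
    by (subst prod.swap) (simp add: prod.cartesian_product case_prod_beta)
  also have "\<dots> = (\<Prod>j\<in>{1..w}. \<Prod>i\<in>{1..m}. e i j ^ i)"
    by (simp only: row)
  also have "\<dots> = (\<Prod>p\<in>{1..m} \<times> {1..w}. e (fst p) (snd p) ^ fst p)"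
    by (subst prod.swap) (simp add: prod.cartesian_product case_prod_beta)
  also have "\<dots> = (\<Prod>p\<in>{1..m} \<times> {1..w}.
      if edge (int (fst p), int (snd p)) (int (fst p), int (snd p) +
        1) \<and> odd (fst p) then -1 else 1)"
    by (intro prod.cong) (auto simp: e_def)
  also have "\<dots> = (\<Prod>k<n. vertical_sign k)"
    unfolding vertical_sign_def
    by (simp only: prod_sign_card finite_SigmaI finite_atLeastAtMost finite_lessThan
        card_odd_vertical_edges[OF bounds])
  finally show ?thesis .
qed

text \<open>Dividing \<open>all_cells_prod\<close> by \<open>vertex_cells_prod\<close> leaves the
  signs of the vertices off the cycle.\<close>

lemma kasteleyn_sign:
  assumes bounds: "\<And>k. 1 \<le> x k \<and> x k \<le> int m \<and> 1 \<le> y k \<and> y k \<le> int w"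
    and outer: "\<And>i j. i \<le> 0 \<or> int m \<le> i \<Longrightarrow> s i j = 1"
  shows "(\<Prod>k<n. east_sign k * south_sign k * vertical_sign k) =
    - ((-1) ^ card {p \<in> {1..m} \<times> {1..w}.
        (int (fst p), int (snd p)) \<notin> range (\<lambda>k. (x k, y k)) \<and> s (int (fst p)) (int (snd p)) = -1})"
proof -
  let ?B = "{1..m} \<times> {1..w}"
  let ?v = "\<lambda>k. (nat (x k), nat (y k))"
  let ?s = "\<lambda>p. s (int (fst p)) (int (snd p))"
  define R where "R = {p \<in> ?B. (int (fst p), int (snd p)) \<notin> range (\<lambda>k. (x k, y k))}"
  have int_v: "int (nat (x k)) = x k" "int (nat (y k)) = y k" for k
    using bounds[of k] by simp_all
  have loop: "?B - R = ?v ` {..<n}"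
  proof (intro equalityI subsetI)
    fix p assume "p \<in> ?B - R"
    then obtain l where l: "(int (fst p), int (snd p)) = (x l, y l)"
      by (auto simp: R_def)
    also have "(x l, y l) = (x (l mod n), y (l mod n))"
      by (simp add: same_vertex_iff del: prod.inject)
    finally have "p = ?v (l mod n)"
      by (auto simp: prod_eq_iff)
    then show "p \<in> ?v ` {..<n}"
      using n_ge_3 by (intro image_eqI[of _ _ "l mod n"]) auto
  next
    fix p assume "p \<in> ?v ` {..<n}"
    then obtain k where "p = ?v k" by blast
    then show "p \<in> ?B - R"
      using bounds[of k] int_v[of k] by (auto simp: R_def)
  qed
  have "inj_on ?v {..<n}"
  proof (rule inj_onI)
    fix k l assume kl: "k \<in> {..<n}" "l \<in> {..<n}" and "?v k = ?v l"
    then have "(x k, y k) = (x l, y l)"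
      using int_v by (metis prod.inject)
    then show "k = l"
      using kl by (simp add: same_vertex_iff del: prod.inject)
  qed
  then have "(\<Prod>p\<in>?B - R. ?s p) = (\<Prod>k<n. s (x k) (y k))"
    unfolding loop by (subst prod.reindex) (simp_all add: int_v del: int_nat_eq)
  moreover have "(\<Prod>p\<in>R. ?s p) = (-1) ^ card {p \<in> R. ?s p = -1}"
  proof -
    have "(\<Prod>p\<in>R. ?s p) = (\<Prod>p\<in>R. if ?s p = -1 then -1 else 1)"
      using s_pm by (intro prod.cong) auto
    then show ?thesis
      by (simp only: prod_sign_card) (simp add: R_def prod_sign_card)
  qed
  moreover have "(\<Prod>p\<in>?B. ?s p) = (\<Prod>p\<in>R. ?s p) * (\<Prod>p\<in>?B - R. ?s p)"
    by (subst prod.subset_diff[of R]) (auto simp: R_def mult.commute)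
  moreover note all_cells_prod[OF bounds outer] vertex_cells_prod
  ultimately have "(\<Prod>k<n. vertical_sign k) =
      (-1) ^ card {p \<in> R. ?s p = -1} * - (\<Prod>k<n. east_sign k * south_sign k)"
    by simp
  moreover have "(\<Prod>k<n. east_sign k * south_sign k) * (\<Prod>k<n. east_sign k * south_sign k) = 1"
    unfolding prod.distrib[symmetric] by (intro prod.neutral) (auto simp: east_sign_def
      south_sign_def)
  ultimately have "(\<Prod>k<n. east_sign k * south_sign k * vertical_sign k) =
      - ((-1) ^ card {p \<in> R. ?s p = -1})"
    by (simp add: prod.distrib)
  also have "{p \<in> R. ?s p = -1} = {p \<in> ?B.
        (int (fst p), int (snd p)) \<notin> range (\<lambda>k. (x k, y k)) \<and> ?s p = -1}"
    by (auto simp: R_def)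
  finally show ?thesis .
qed

end

section \<open>Cells inside a lattice cycle\<close>

definition lattice_point :: "int \<times> int \<Rightarrow> complex" where
  "lattice_point p = Complex (of_int (fst p)) (of_int (snd p))"

definition horizontal_segment :: "int \<Rightarrow> int \<Rightarrow> complex set" where
  "horizontal_segment i j = {z. Im z = of_int j \<and> of_int i \<le> Re z \<and> Re z \<le> of_int i + 1}"

definition vertical_segment :: "int \<Rightarrow> int \<Rightarrow> complex set" where
  "vertical_segment i j = {z. Re z = of_int i \<and> of_int j \<le> Im z \<and> Im z \<le> of_int j + 1}"

lemma closed_segment_horizontal:
  "closed_segment (lattice_point (i, j)) (lattice_point (i + 1, j)) = horizontal_segment i j"
  "closed_segment (lattice_point (i + 1, j)) (lattice_point (i, j)) = horizontal_segment i j"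
  by (auto simp: closed_segment_same_Im closed_segment_eq_real_ivl lattice_point_def
    horizontal_segment_def)

lemma closed_segment_vertical:
  "closed_segment (lattice_point (i, j)) (lattice_point (i, j + 1)) = vertical_segment i j"
  "closed_segment (lattice_point (i, j + 1)) (lattice_point (i, j)) = vertical_segment i j"
  by (auto simp: closed_segment_same_Re closed_segment_eq_real_ivl lattice_point_def
    vertical_segment_def)

lemma unit_edge_cases:
  assumes "unit_step (fst q - fst p) (snd q - snd p)"
  obtains (horizontal) i j where "{p, q} = {(i, j), (i + 1, j)}"
      "closed_segment (lattice_point p) (lattice_point q) = horizontal_segment i j"
  | (vertical) i j where "{p, q} = {(i, j), (i, j + 1)}"
      "closed_segment (lattice_point p) (lattice_point q) = vertical_segment i j"
proof -
  obtain a b c d where pq: "p = (a, b)" "q = (c, d)"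
    by fastforce
  from assms show ?thesis
  proof (cases rule: unit_step_cases)
    case 1
    then have "q = (a + 1, b)"
      by (simp add: pq)
    then show ?thesis
      using horizontal[of a b] by (simp add: pq closed_segment_horizontal)
  next
    case 2
    then have "p = (c + 1, d)" "q = (c, d)"
      by (simp_all add: pq)
    then show ?thesis
      using horizontal[of c d] by (simp add: closed_segment_horizontal insert_commute)
  next
    case 3
    then have "q = (a, b + 1)"
      by (simp add: pq)
    then show ?thesis
      using vertical[of a b] by (simp add: pq closed_segment_vertical)
  next
    case 4
    then have "p = (c, d + 1)" "q = (c, d)"
      by (simp_all add: pq)
    then show ?thesis
      using vertical[of c d] by (simp add: closed_segment_vertical insert_commute)
  qed
qed

lemma of_int_interval_overlap:
  fixes t :: real
  assumes "of_int i \<le> t" "t \<le> of_int i + 1" "of_int j \<le> t" "t \<le> of_int j + 1"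
  shows "i = j \<or> i = j + 1 \<and> t = of_int i \<or> j = i + 1 \<and> t = of_int j"
proof -
  have "of_int i \<le> (of_int (j + 1) :: real)" "of_int j \<le> (of_int (i + 1) :: real)"
    using assms by simp_all
  then have "i \<le> j + 1" "j \<le> i + 1"
    by (simp_all only: of_int_le_iff)
  then consider "i = j" | "i = j + 1" | "j = i + 1"
    by linarith
  then show ?thesis
    using assms by cases auto
qed

text \<open>Integrality does the work: distinct parallel edges touch only if collinear and adjacent,
  and a horizontal and a vertical edge can meet only at a lattice point, which then ends
  both.\<close>

lemma unit_segments_Int:
  assumes "unit_step (fst q - fst p) (snd q - snd p)" "unit_step (fst r' - fst r) (snd r' - snd r)"
    and ne: "{p, q} \<noteq> {r, r'}"
    and z: "z \<in> closed_segment (lattice_point p) (lattice_point q)"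
      "z \<in> closed_segment (lattice_point r) (lattice_point r')"
  shows "\<exists>u \<in> {p, q} \<inter> {r, r'}. z = lattice_point u"
proof (cases rule: unit_edge_cases[OF assms(1)])
  case h1: (1 i j)
  show ?thesis
  proof (cases rule: unit_edge_cases[OF assms(2)])
    case h2: (1 k l)
    have "j = l"
      using z h1 h2 by (auto simp: horizontal_segment_def)
    moreover have "i = k \<or> i = k + 1 \<and> Re z = of_int i \<or> k = i + 1 \<and> Re z = of_int k"
      by (rule of_int_interval_overlap) (use z h1 h2 in \<open>auto simp: horizontal_segment_def\<close>)
    ultimately show ?thesis
      using z(1) ne unfolding h1 h2 
      by (auto simp: horizontal_segment_def lattice_point_def complex_eq_iff)
  next
    case v2: (2 k l)
    have "of_int i \<le> (of_int k :: real)" "of_int k \<le> (of_int (i + 1) :: real)"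
      "of_int l \<le> (of_int j :: real)" "of_int j \<le> (of_int (l + 1) :: real)"
      using z h1 v2 by (auto simp: horizontal_segment_def vertical_segment_def)
    then have "k = i \<or> k = i + 1" "j = l \<or> j = l + 1"
      unfolding of_int_le_iff by linarith+
    moreover have "z = lattice_point (k, j)"
      using z h1 v2 by (auto simp: horizontal_segment_def vertical_segment_def lattice_point_def
        complex_eq_iff)
    ultimately show ?thesis
      unfolding h1 v2 by (intro bexI[of _ "(k, j)"]) auto
  qed
next
  case v1: (2 i j)
  show ?thesis
  proof (cases rule: unit_edge_cases[OF assms(2)])
    case h2: (1 k l)
    have "of_int k \<le> (of_int i :: real)" "of_int i \<le> (of_int (k + 1) :: real)"
      "of_int j \<le> (of_int l :: real)" "of_int l \<le> (of_int (j + 1) :: real)"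
      using z v1 h2 by (auto simp: horizontal_segment_def vertical_segment_def)
    then have "i = k \<or> i = k + 1" "l = j \<or> l = j + 1"
      unfolding of_int_le_iff by linarith+
    moreover have "z = lattice_point (i, l)"
      using z v1 h2 by (auto simp: horizontal_segment_def vertical_segment_def lattice_point_def
        complex_eq_iff)
    ultimately show ?thesis
      unfolding v1 h2 by (intro bexI[of _ "(i, l)"]) auto
  next
    case v2: (2 k l)
    have "i = k"
      using z v1 v2 by (auto simp: vertical_segment_def)
    moreover have "j = l \<or> j = l + 1 \<and> Im z = of_int j \<or> l = j + 1 \<and> Im z = of_int l"
      by (rule of_int_interval_overlap) (use z v1 v2 in \<open>auto simp: vertical_segment_def\<close>)
    ultimately show ?thesis
      using z(1) ne unfolding v1 v2 
      by (auto simp: vertical_segment_def lattice_point_def complex_eq_iff)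
  qed
qed

text \<open>The open form serves single cells and pairs of adjacent cells, the half-open form a cell
  together with its south-west corner.\<close>

lemma convex_box_complex:
  "convex {z. a < Re z \<and> Re z < b \<and> c < Im z \<and> Im z < d}"
  "convex {z. a \<le> Re z \<and> Re z < b \<and> c \<le> Im z \<and> Im z < d}"
proof -
  have "convex ({z. a < Re z} \<inter> {z. Re z < b} \<inter> {z. c < Im z} \<inter> {z. Im z < d})"
    by (intro convex_Int convex_halfspace_Re_gt convex_halfspace_Re_lt convex_halfspace_Im_gt
        convex_halfspace_Im_lt)
  then show "convex {z. a < Re z \<and> Re z < b \<and> c < Im z \<and> Im z < d}"
    by (simp add: Int_def conj_assoc)
  have "convex ({z. a \<le> Re z} \<inter> {z. Re z < b} \<inter> {z. c \<le> Im z} \<inter> {z. Im z < d})"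
    by (intro convex_Int convex_halfspace_Re_ge convex_halfspace_Re_lt convex_halfspace_Im_ge
        convex_halfspace_Im_lt)
  then show "convex {z. a \<le> Re z \<and> Re z < b \<and> c \<le> Im z \<and> Im z < d}"
    by (simp add: Int_def conj_assoc)
qed

section \<open>The polygon of a lattice cycle as a Jordan curve\<close>

context lattice_cycle
begin

definition vertex :: "nat \<Rightarrow> int \<times> int" where
  "vertex k = (x k, y k)"

definition curve :: "complex set" where
  "curve = (\<Union>k<n. closed_segment (lattice_point (vertex k)) (lattice_point (vertex (Suc k))))"

lemma vertex_eq_iff: "vertex i = vertex j \<longleftrightarrow> i mod n = j mod n"
  unfolding vertex_def by (rule same_vertex_iff)

lemma step_vertex: "unit_step (fst (vertex (Suc k)) - fst (vertex k)) (snd (vertex (Suc k)) - snd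
  (vertex k))"
  using step by (simp add: vertex_def)

lemma edge_vertex: "edge p q \<longleftrightarrow> (\<exists>k. {p, q} = {vertex k, vertex (Suc k)})"
  by (simp add: edge_def vertex_def)

lemma curve_eq_UN: "curve = (\<Union>k. closed_segment (lattice_point (vertex k)) (lattice_point (vertex
  (Suc k))))"
proof (intro equalityI subsetI)
  fix z assume "z \<in> (\<Union>k. closed_segment (lattice_point (vertex k)) (lattice_point (vertex (Suc
    k))))"
  then obtain k where k: "z \<in> closed_segment (lattice_point (vertex k)) (lattice_point (vertex
    (Suc k)))"
    by blast
  have "vertex (k mod n) = vertex k" "vertex (Suc (k mod n)) = vertex (Suc k)"
    by (simp_all add: vertex_eq_iff mod_Suc_eq)
  with k show "z \<in> curve"
    using n_ge_3 unfolding curve_def by (intro UN_I[of "k mod n"]) auto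
qed (auto simp: curve_def)

lemma curve_eq:
  "z \<in> curve \<longleftrightarrow> (\<exists>i j. edge (i, j) (i + 1, j) \<and> z \<in> horizontal_segment i j) \<or>
     (\<exists>i j. edge (i, j) (i, j + 1) \<and> z \<in> vertical_segment i j)"
proof
  assume "z \<in> curve"
  then obtain k where k: "z \<in> closed_segment (lattice_point (vertex k)) (lattice_point (vertex
    (Suc k)))"
    by (auto simp: curve_def)
  from step_vertex[of k] show "(\<exists>i j. edge (i, j) (i + 1, j) \<and> z \<in> horizontal_segment i j) \<or>
     (\<exists>i j. edge (i, j) (i, j + 1) \<and> z \<in> vertical_segment i j)"
    by (cases rule: unit_edge_cases) (use k edge_vertex in metis)+
next
  have "closed_segment (lattice_point p) (lattice_point q) \<subseteq> curve" if e: "edge p q" for p q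
  proof -
    from e obtain k where "{p, q} = {vertex k, vertex (Suc k)}"
      by (auto simp: edge_vertex)
    then have "closed_segment (lattice_point p) (lattice_point q) =
        closed_segment (lattice_point (vertex k)) (lattice_point (vertex (Suc k)))"
      by (auto simp: doubleton_eq_iff closed_segment_commute)
    also have "\<dots> \<subseteq> curve"
      by (auto simp: curve_eq_UN)
    finally show ?thesis .
  qed
  then show "(\<exists>i j. edge (i, j) (i + 1, j) \<and> z \<in> horizontal_segment i j) \<or>
     (\<exists>i j. edge (i, j) (i, j + 1) \<and> z \<in> vertical_segment i j) \<Longrightarrow> z \<in> curve"
    unfolding closed_segment_horizontal[symmetric] closed_segment_vertical[symmetric] by blast
qed

lemma segments_Int:
  assumes "k < j" "j < n"
    and "z \<in> closed_segment (lattice_point (vertex k)) (lattice_point (vertex (Suc k)))"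
    and "z \<in> closed_segment (lattice_point (vertex j)) (lattice_point (vertex (Suc j)))"
  shows "Suc k = j \<and> z = lattice_point (vertex j) \<or> k = 0 \<and> Suc j = n \<and> z =
    lattice_point (vertex 0)"
proof -
  have vs: "vertex k \<noteq> vertex j" "vertex (Suc k) \<noteq> vertex (Suc j)"
    "vertex (Suc k) = vertex j \<longleftrightarrow> Suc k = j" "vertex k = vertex (Suc j) \<longleftrightarrow> k = 0 \<and> Suc j = n"
  proof -
    show "vertex k \<noteq> vertex j"
      using assms by (simp add: vertex_eq_iff)
    then show "vertex (Suc k) \<noteq> vertex (Suc j)"
      unfolding vertex_def using same_vertex_Suc_iff by blast
    show "vertex (Suc k) = vertex j \<longleftrightarrow> Suc k = j"
      using assms by (simp add: vertex_eq_iff)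
    show "vertex k = vertex (Suc j) \<longleftrightarrow> k = 0 \<and> Suc j = n"
      using assms by (cases "Suc j = n") (auto simp: vertex_eq_iff)
  qed
  have "{vertex k, vertex (Suc k)} \<noteq> {vertex j, vertex (Suc j)}"
    using vs n_ge_3 by (auto simp: doubleton_eq_iff)
  from unit_segments_Int[OF step_vertex step_vertex this assms(3,4)]
  obtain u where "u \<in> {vertex k, vertex (Suc k)}" "u \<in> {vertex j, vertex (Suc j)}" "z =
    lattice_point u"
    by blast
  then show ?thesis
    using vs by auto
qed

lemma lattice_point_inj: "lattice_point p = lattice_point q \<longleftrightarrow> p = q"
  by (auto simp: lattice_point_def prod_eq_iff)

text \<open>By induction the initial pieces are arcs, each new segment meeting the old ones only at
  its start; the last segment closes the arc because vertex \<open>n\<close> is vertex 0.\<close>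

lemma simple_closed_curve:
  "\<exists>c. simple_path c \<and> pathfinish c = pathstart c \<and> path_image c = curve"
proof -
  let ?p = "\<lambda>k. lattice_point (vertex k)"
  let ?seg = "\<lambda>k. closed_segment (?p k) (?p (Suc k))"
  have arc_seg: "arc (linepath (?p k) (?p (Suc k)))" for k
    using n_ge_3 same_vertex_iff[of k "Suc k"] simple[of k "Suc k"]
    by (intro arc_linepath) (auto simp: lattice_point_inj vertex_def)
  have arcs: "\<exists>g. arc g \<and> pathstart g = ?p 0 \<and> pathfinish g = ?p j \<and> path_image g = (\<Union>k<j. ?seg k)"
    if "1 \<le> j" "j < n" for j
    using that
  proof (induction j rule: dec_induct)
    case base
    show ?case
      by (rule exI[of _ "linepath (?p 0) (?p 1)"]) (use arc_seg[of 0] in auto)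
  next
    case (step j)
    then obtain g where g: "arc g" "pathstart g = ?p 0" "pathfinish g = ?p j" "path_image g =
      (\<Union>k<j. ?seg k)"
      by auto
    have "arc (g +++ linepath (?p j) (?p (Suc j)))"
    proof (rule arc_join[OF g(1) arc_seg])
      show "path_image g \<inter> path_image (linepath (?p j) (?p (Suc j))) \<subseteq> {pathstart (linepath (?p j)
        (?p (Suc j)))}"
        using segments_Int[of _ j] step.prems by (fastforce simp: g(4))
    qed (use g in simp_all)
    moreover have "path_image (g +++ linepath (?p j) (?p (Suc j))) = (\<Union>k<Suc j. ?seg k)"
      using g by (subst path_image_join) (auto simp: lessThan_Suc)
    ultimately show ?case
      using g by (intro exI[of _ "g +++ linepath (?p j) (?p (Suc j))"]) auto
  qed
  define j where "j = n - 1"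
  have j: "Suc j = n" "1 \<le> j" "j < n"
    using n_ge_3 by (simp_all add: j_def)
  obtain g where g: "arc g" "pathstart g = ?p 0" "pathfinish g = ?p j" "path_image g =
    (\<Union>k<j. ?seg k)"
    using arcs[OF j(2,3)] by blast
  have last: "vertex (Suc j) = vertex 0"
    by (simp add: vertex_eq_iff j)
  have "simple_path (g +++ linepath (?p j) (?p (Suc j)))"
  proof (rule simple_path_join_loop[OF g(1) arc_seg])
    show "path_image g \<inter> path_image (linepath (?p j) (?p (Suc j))) \<subseteq>
        {pathstart g, pathstart (linepath (?p j) (?p (Suc j)))}"
      using segments_Int[of _ j] j by (fastforce simp: g)
  qed (use g last in simp_all)
  moreover have "path_image (g +++ linepath (?p j) (?p (Suc j))) = (\<Union>k<Suc j. ?seg k)"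
    using g by (subst path_image_join) (auto simp: lessThan_Suc)
  moreover have "\<dots> = curve"
    by (simp only: curve_def j(1))
  ultimately show ?thesis
    using g last by (intro exI[of _ "g +++ linepath (?p j) (?p (Suc j))"]) auto
qed

lemma jordan:
  "open (inside curve)" "open (outside curve)" "inside curve \<inter> outside curve = {}"
  "inside curve \<union> outside curve = - curve"
  "frontier (inside curve) = curve" "frontier (outside curve) = curve"
  using simple_closed_curve Jordan_inside_outside by (metis (no_types, lifting))+

lemma convex_same_side:
  assumes "convex A" "A \<inter> curve = {}" "a \<in> A" "b \<in> A"
  shows "a \<in> inside curve \<longleftrightarrow> b \<in> inside curve"
proof -
  have "inside curve \<inter> A = {} \<or> outside curve \<inter> A = {}"
    by (rule connectedD[OF convex_connected[OF assms(1)] jordan(1,2)])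
       (use jordan assms in auto)
  then show ?thesis
    using jordan(3,4) assms by blast
qed

text \<open>By the Jordan curve theorem \<open>p\<close> is a limit of inside and of outside points.
  Near \<open>p\<close> these can only lie in \<open>A\<close> or \<open>B\<close>, and each of
  these sets is on one side.\<close>

lemma opposite_sides:
  assumes A: "convex A" "A \<inter> curve = {}" "a \<in> A" and B: "convex B" "B \<inter> curve = {}" "b \<in> B"
    and p: "p \<in> curve" and cover: "0 < r" "ball p r \<subseteq> A \<union> B \<union> curve"
  shows "a \<in> inside curve \<longleftrightarrow> b \<notin> inside curve"
proof -
  have "p \<in> closure (inside curve)" "p \<in> closure (outside curve)"
    using p jordan(5,6) by (auto simp: frontier_def)
  then obtain u v where u: "u \<in> inside curve" "dist u p < r" and
    v: "v \<in> outside curve" "dist v p < r"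
    using \<open>0 < r\<close> by (meson closure_approachable)
  have "u \<in> A \<union> B" "v \<in> A \<union> B"
  proof -
    have "u \<in> ball p r" "v \<in> ball p r"
      using u v by (simp_all add: dist_commute)
    then show "u \<in> A \<union> B" "v \<in> A \<union> B"
      using u(1) v(1) cover(2) jordan(4) by blast+
  qed
  moreover have "v \<notin> inside curve"
    using v jordan(3) by blast
  ultimately show ?thesis
    using convex_same_side[OF A(1,2)] convex_same_side[OF B(1,2)] A(3) B(3) u(1) by blast
qed

section \<open>Inside and outside for unit cells\<close>

definition cell :: "int \<Rightarrow> int \<Rightarrow> complex set" where
  "cell i j = {z. of_int i < Re z \<and> Re z < of_int i + 1 \<and> of_int j < Im z \<and> Im z < of_int j + 1}"

definition center :: "int \<Rightarrow> int \<Rightarrow> complex" where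
  "center i j = Complex (of_int i + 1/2) (of_int j + 1/2)"

definition cell_sign :: "int \<Rightarrow> int \<Rightarrow> int" where
  "cell_sign i j = (if center i j \<in> inside curve then -1 else 1)"

lemma convex_cell: "convex (cell i j)"
  unfolding cell_def by (rule convex_box_complex)

lemma center_in_cell: "center i j \<in> cell i j"
  by (simp add: center_def cell_def)

lemma of_int_strict_between:
  assumes "of_int i < (of_int k :: real)" "of_int k < (of_int i + 1 :: real)"
  shows False
proof -
  have "of_int k < (of_int (i + 1) :: real)"
    using assms(2) by simp
  then show False
    using assms(1) unfolding of_int_less_iff by linarith
qed

lemma cell_Int_curve: "cell i j \<inter> curve = {}"
proof (rule ccontr)
  assume "cell i j \<inter> curve \<noteq> {}"
  then obtain z where z: "z \<in> cell i j" "z \<in> curve" by blast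
  from z(2)[unfolded curve_eq] show False
  proof (elim disjE exE conjE)
    fix k l assume "z \<in> horizontal_segment k l"
    then show False
      using z(1) of_int_strict_between[of j l] by (simp add: cell_def horizontal_segment_def)
  next
    fix k l assume "z \<in> vertical_segment k l"
    then show False
      using z(1) of_int_strict_between[of i k] by (simp add: cell_def vertical_segment_def)
  qed
qed

lemma cell_sign_horizontal:
  "cell_sign i (j - 1) = (if edge (i, j) (i + 1, j) then - cell_sign i j else cell_sign i j)"
proof (cases "edge (i, j) (i + 1, j)")
  case True
  \<comment> \<open>The midpoint of the edge: its disc of radius 1/2 meets only the two adjacent
    cells and the edge itself.\<close>
  let ?p = "Complex (of_int i + 1/2) (of_int j)"
  have hs: "horizontal_segment i j \<subseteq> curve"
    using True curve_eq by blast
  have "center i (j - 1) \<in> inside curve \<longleftrightarrow> center i j \<notin> inside curve"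
  proof (rule opposite_sides[OF convex_cell cell_Int_curve center_in_cell convex_cell
    cell_Int_curve center_in_cell])
    show "?p \<in> curve"
      using hs by (auto simp: horizontal_segment_def)
    show "ball ?p (1/2) \<subseteq> cell i (j - 1) \<union> cell i j \<union> curve"
    proof
      fix z assume "z \<in> ball ?p (1/2)"
      then have "\<bar>Re (z - ?p)\<bar> < 1/2" "\<bar>Im (z - ?p)\<bar> < 1/2"
        using abs_Re_le_cmod[of "z - ?p"] abs_Im_le_cmod[of "z - ?p"]
        by (simp_all add: dist_norm norm_minus_commute)
      then have z: "of_int i < Re z" "Re z < of_int i + 1" "of_int j - 1 < Im z" "Im z < of_int j
        + 1"
        unfolding minus_complex.simps complex.sel by linarith+
      show "z \<in> cell i (j - 1) \<union> cell i j \<union> curve"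
      proof (cases "Im z = of_int j")
        case True
        then have "z \<in> horizontal_segment i j"
          using z by (simp add: horizontal_segment_def)
        then show ?thesis
          using hs by blast
      qed (use z in \<open>auto simp: cell_def\<close>)
    qed
  qed simp
  then show ?thesis
    using True by (simp add: cell_sign_def)
next
  case False
  \<comment> \<open>Without the edge, the two open cells and the open side between them form a
    convex set free of the curve.\<close>
  let ?A = "{z. of_int i < Re z \<and> Re z < of_int i + 1 \<and> of_int j - 1 < Im z \<and> Im z < of_int j + 1}"
  have "center i (j - 1) \<in> inside curve \<longleftrightarrow> center i j \<in> inside curve"
  proof (rule convex_same_side[OF convex_box_complex(1)])
    show "?A \<inter> curve = {}"
    proof (rule ccontr)
      assume "?A \<inter> curve \<noteq> {}"
      then obtain z where z: "z \<in> ?A" "z \<in> curve" by blast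
      from z(2)[unfolded curve_eq] show False
      proof (elim disjE exE conjE)
        fix k l assume e: "edge (k, l) (k + 1, l)" and kl: "z \<in> horizontal_segment k l"
        have "l = j"
          using z(1) kl by (auto simp: horizontal_segment_def)
        moreover have "k = i"
          using of_int_interval_overlap[of k "Re z" i] z(1) kl by (auto simp:
            horizontal_segment_def)
        ultimately show False
          using e False by simp
      next
        fix k l assume "z \<in> vertical_segment k l"
        then show False
          using z(1) of_int_strict_between[of i k] by (auto simp: vertical_segment_def)
      qed
    qed
  qed (auto simp: center_def)
  then show ?thesis
    using False by (simp add: cell_sign_def)
qed

lemma cell_sign_vertical:
  "cell_sign (i - 1) j = (if edge (i, j) (i, j + 1) then - cell_sign i j else cell_sign i j)"
proof (cases "edge (i, j) (i, j + 1)")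
  case True
  let ?p = "Complex (of_int i) (of_int j + 1/2)"
  have vs: "vertical_segment i j \<subseteq> curve"
    using True curve_eq by blast
  have "center (i - 1) j \<in> inside curve \<longleftrightarrow> center i j \<notin> inside curve"
  proof (rule opposite_sides[OF convex_cell cell_Int_curve center_in_cell convex_cell
    cell_Int_curve center_in_cell])
    show "?p \<in> curve"
      using vs by (auto simp: vertical_segment_def)
    show "ball ?p (1/2) \<subseteq> cell (i - 1) j \<union> cell i j \<union> curve"
    proof
      fix z assume "z \<in> ball ?p (1/2)"
      then have "\<bar>Re (z - ?p)\<bar> < 1/2" "\<bar>Im (z - ?p)\<bar> < 1/2"
        using abs_Re_le_cmod[of "z - ?p"] abs_Im_le_cmod[of "z - ?p"]
        by (simp_all add: dist_norm norm_minus_commute)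
      then have z: "of_int i - 1 < Re z" "Re z < of_int i + 1" "of_int j < Im z" "Im z < of_int j
        + 1"
        unfolding minus_complex.simps complex.sel by linarith+
      show "z \<in> cell (i - 1) j \<union> cell i j \<union> curve"
      proof (cases "Re z = of_int i")
        case True
        then have "z \<in> vertical_segment i j"
          using z by (simp add: vertical_segment_def)
        then show ?thesis
          using vs by blast
      qed (use z in \<open>auto simp: cell_def\<close>)
    qed
  qed simp
  then show ?thesis
    using True by (simp add: cell_sign_def)
next
  case False
  let ?A = "{z. of_int i - 1 < Re z \<and> Re z < of_int i + 1 \<and> of_int j < Im z \<and> Im z < of_int j + 1}"
  have "center (i - 1) j \<in> inside curve \<longleftrightarrow> center i j \<in> inside curve"
  proof (rule convex_same_side[OF convex_box_complex(1)])
    show "?A \<inter> curve = {}"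
    proof (rule ccontr)
      assume "?A \<inter> curve \<noteq> {}"
      then obtain z where z: "z \<in> ?A" "z \<in> curve" by blast
      from z(2)[unfolded curve_eq] show False
      proof (elim disjE exE conjE)
        fix k l assume "z \<in> horizontal_segment k l"
        then show False
          using z(1) of_int_strict_between[of j l] by (auto simp: horizontal_segment_def)
      next
        fix k l assume e: "edge (k, l) (k, l + 1)" and kl: "z \<in> vertical_segment k l"
        have "k = i"
          using z(1) kl by (auto simp: vertical_segment_def)
        moreover have "l = j"
          using of_int_interval_overlap[of l "Im z" j] z(1) kl by (auto simp: vertical_segment_def)
        ultimately show False
          using e False by simp
      qed
    qed
  qed (auto simp: center_def)
  then show ?thesis
    using False by (simp add: cell_sign_def)
qed

text \<open>A vertex off the cycle has no incident edge on it, so the half-open box at this corner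
  misses the curve and joins the vertex to the center of its north-east cell.\<close>

lemma vertex_inside_iff:
  assumes "p \<notin> range vertex"
  shows "lattice_point p \<in> inside curve \<longleftrightarrow> cell_sign (fst p) (snd p) = -1"
proof -
  obtain i j where p: "p = (i, j)" by fastforce
  let ?A = "{z. of_int i \<le> Re z \<and> Re z < of_int i + 1 \<and> of_int j \<le> Im z \<and> Im z < of_int j + 1}"
  have no_edge: "\<not> edge p q" "\<not> edge q p" for q
    using assms by (auto simp: edge_vertex doubleton_eq_iff)
  have "lattice_point p \<in> inside curve \<longleftrightarrow> center i j \<in> inside curve"
  proof (rule convex_same_side[OF convex_box_complex(2)])
    show "?A \<inter> curve = {}"
    proof (rule ccontr)
      assume "?A \<inter> curve \<noteq> {}"
      then obtain z where z: "z \<in> ?A" "z \<in> curve" by blast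
      from z(2)[unfolded curve_eq] show False
      proof (elim disjE exE conjE)
        fix k l assume e: "edge (k, l) (k + 1, l)" and kl: "z \<in> horizontal_segment k l"
        have "l = j"
          using z(1) kl by (auto simp: horizontal_segment_def)
        moreover have "k = i \<or> i = k + 1"
          using of_int_interval_overlap[of k "Re z" i] z(1) kl by (auto simp:
            horizontal_segment_def)
        ultimately show False
          using e no_edge p by auto
      next
        fix k l assume e: "edge (k, l) (k, l + 1)" and kl: "z \<in> vertical_segment k l"
        have "k = i"
          using z(1) kl by (auto simp: vertical_segment_def)
        moreover have "l = j \<or> j = l + 1"
          using of_int_interval_overlap[of l "Im z" j] z(1) kl by (auto simp: vertical_segment_def)
        ultimately show False
          using e no_edge p by auto
      qed
    qed
  qed (auto simp: center_def lattice_point_def p)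
  then show ?thesis
    by (simp add: cell_sign_def p)
qed

lemma vertex_not_inside: "lattice_point (vertex k) \<notin> inside curve"
proof -
  have "lattice_point (vertex k) \<in> curve"
    by (auto simp: curve_eq_UN)
  then show ?thesis
    using inside_no_overlap by blast
qed

text \<open>The curve lies in a convex vertical strip, whose complement is outside, and centers have
  real part \<open>i + 1/2\<close>.\<close>

lemma cell_sign_outer:
  assumes "\<And>k. 1 \<le> x k \<and> x k \<le> M" "i \<le> 0 \<or> M \<le> i"
  shows "cell_sign i j = 1"
proof -
  let ?B = "{z. 1 \<le> Re z} \<inter> {z. Re z \<le> of_int M}"
  have "convex ?B"
    by (intro convex_Int convex_halfspace_Re_ge convex_halfspace_Re_le)
  moreover have "curve \<subseteq> ?B"
  proof -
    have "lattice_point (vertex k) \<in> ?B" for k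
      using assms(1)[of k] by (simp add: lattice_point_def vertex_def)
    then show ?thesis
      unfolding curve_def using closed_segment_subset[OF _ _ \<open>convex ?B\<close>] by blast
  qed
  ultimately have "- ?B \<subseteq> outside curve"
    by (rule outside_subset_convex)
  moreover have "center i j \<in> - ?B"
  proof -
    have "of_int i \<le> (0 :: real) \<or> of_int M \<le> (of_int i :: real)"
      using assms(2) by simp
    then show ?thesis
      by (auto simp: center_def)
  qed
  ultimately have "center i j \<in> outside curve"
    by (rule subsetD)
  then have "center i j \<notin> inside curve"
    using jordan(3) by blast
  then show ?thesis
    by (simp add: cell_sign_def)
qed

theorem kasteleyn_sign_inside:
  assumes "even n" and "\<And>k. y 0 < y k \<or> y 0 = y k \<and> x 0 \<le> x k"
    and bounds: "\<And>k. 1 \<le> x k \<and> x k \<le> int m \<and> 1 \<le> y k \<and> y k \<le> int w"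
  shows "(\<Prod>k<n. east_sign k * south_sign k * vertical_sign k) =
    - ((-1) ^ card {p \<in> {1..m} \<times> {1..w}. lattice_point (int (fst p), int (snd p)) \<in> inside curve})"
proof -
  interpret cells: lattice_cycle_cells x y n cell_sign
    by unfold_locales
       (use assms cell_sign_horizontal cell_sign_vertical in \<open>auto simp: cell_sign_def\<close>)
  have "(\<Prod>k<n. east_sign k * south_sign k * vertical_sign k) =
    - ((-1) ^ card {p \<in> {1..m} \<times> {1..w}.
        (int (fst p), int (snd p)) \<notin> range (\<lambda>k. (x k, y k)) \<and> cell_sign (int (fst p)) (int (snd
          p)) = -1})"
    using bounds cell_sign_outer[of "int m"] by (intro cells.kasteleyn_sign) blast+
  moreover have "((int i, int j) \<notin> range (\<lambda>k. (x k, y k)) \<and> cell_sign (int i) (int j) = -1) \<longleftrightarrow>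
      lattice_point (int i, int j) \<in> inside curve" for i j
  proof (cases "(int i, int j) \<in> range vertex")
    case True
    then obtain k where "(int i, int j) = vertex k"
      by blast
    then show ?thesis
      using vertex_not_inside[of k] by (simp add: vertex_def)
  next
    case False
    then show ?thesis
      using vertex_inside_iff[OF False] by (simp add: vertex_def)
  qed
  ultimately show ?thesis
    by simp
qed

end

section \<open>Permutations and monopole-dimer configurations\<close>

text \<open>Fixed points are dropped because they correspond to monopoles, which carry no
  arcs.\<close>

definition perm_arcs :: "('v \<Rightarrow> 'v) \<Rightarrow> ('v \<times> 'v) set" where
  "perm_arcs p = {(v, p v) | v. p v \<noteq> v}"

lemma perm_arcs_inj: "perm_arcs p = perm_arcs q \<Longrightarrow> p = q"
proof (rule ext)
  fix v assume "perm_arcs p = perm_arcs q"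
  then have "(v, u) \<in> perm_arcs p \<longleftrightarrow> (v, u) \<in> perm_arcs q" for u
    by simp
  from this[of "p v"] this[of "q v"] show "p v = q v"
    by (auto simp: perm_arcs_def)
qed

lemma sign_cycle_of_list: "distinct cs \<Longrightarrow> sign (cycle_of_list cs) = (-1) ^ (length cs - 1)"
proof (induction cs rule: cycle_of_list.induct)
  case (1 i j cs)
  then have "sign (cycle_of_list (i # j # cs)) = sign (Transposition.transpose i j) *
    sign (cycle_of_list (j # cs))"
    unfolding cycle_of_list.simps by (intro sign_compose permutation_swap_id permutation_of_cycle)
  also have "\<dots> = (-1) ^ (length (i # j # cs) - 1)"
    using 1 by (simp add: sign_swap_id)
  finally show ?case .
qed simp_all

lemma cycle_of_list_map: "distinct cs \<Longrightarrow> map (cycle_of_list cs) cs = rotate1 cs"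
  using cyclic_rotation[of cs 1] by simp

lemma zip_rotate1_eq_image:
  "distinct cs \<Longrightarrow> set (zip cs (rotate1 cs)) = (\<lambda>v. (v, cycle_of_list cs v)) ` set cs"
  by (simp add: cycle_of_list_map[symmetric] zip_map2 zip_same_conv_map)

lemma zip_rotate1_conv_nth:
  "set (zip vs (rotate1 vs)) = (\<lambda>i. (vs ! i, vs ! (Suc i mod length vs))) ` {..<length vs}"
  by (auto simp: set_zip nth_rotate1)

lemma cycle_of_list_moves:
  assumes "distinct cs" "2 \<le> length cs" "v \<in> set cs"
  shows "cycle_of_list cs v \<noteq> v"
proof -
  obtain i where i: "i < length cs" "v = cs ! i"
    using assms(3) by (metis in_set_conv_nth)
  have "cycle_of_list cs v = map (cycle_of_list cs) cs ! i"
    using i by simp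
  also have "\<dots> = cs ! (Suc i mod length cs)"
    using i assms(1) by (simp add: cycle_of_list_map nth_rotate1)
  also have "\<dots> \<noteq> cs ! i"
    using assms i by (subst nth_eq_iff_index_eq) (auto simp: mod_Suc)
  finally show ?thesis
    using i by simp
qed

lemma directed_loop_cycle:
  assumes "directed_loop E L"
  obtains cs where "distinct cs" "2 \<le> length cs" "even (length cs)" "L = set (zip cs (rotate1 cs))"
    "L = (\<lambda>v. (v, cycle_of_list cs v)) ` set cs" "loop_verts L = set cs"
    "perm_arcs (cycle_of_list cs) = L"
proof -
  obtain cs where cs: "distinct cs" "2 \<le> length cs" "even (length cs)" "L =
    set (zip cs (rotate1 cs))"
    using assms by (auto simp: directed_loop_def)
  moreover have L: "L = (\<lambda>v. (v, cycle_of_list cs v)) ` set cs"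
    using cs zip_rotate1_eq_image by blast
  moreover from L have "loop_verts L = set cs"
    by (force simp: loop_verts_def image_image)
  moreover have "perm_arcs (cycle_of_list cs) = L"
    unfolding L using cycle_of_list_moves[OF cs(1,2)] id_outside_supp[of _ cs]
    by (fastforce simp: perm_arcs_def)
  ultimately show ?thesis
    using that by blast
qed

lemma perm_arcs_disjoint_compose:
  assumes "p permutes A" "q permutes B" "A \<inter> B = {}"
  shows "perm_arcs (q \<circ> p) = perm_arcs q \<union> perm_arcs p"
proof -
  have "(q \<circ> p) v = (if v \<in> A then p v else q v)" for v
  proof (cases "v \<in> A")
    case True
    then have "p v \<notin> B"
      using assms by (metis disjoint_iff permutes_in_image)
    then show ?thesis
      using True assms(2) by (simp add: permutes_not_in)
  qed (use assms(1) in \<open>simp add: permutes_not_in\<close>)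
  moreover have "p v = v" if "v \<notin> A" for v
    using that assms(1) by (simp add: permutes_not_in)
  moreover have "q v = v" if "v \<in> A" for v
    using that assms by (metis disjoint_iff permutes_not_in)
  ultimately show ?thesis
    unfolding perm_arcs_def by fastforce
qed

text \<open>In a single-valued set of arcs every vertex has one successor, so following
  \<open>L\<close> from the common arc never leaves \<open>M\<close> and runs through all of
  \<open>L\<close>.\<close>

lemma loop_subset_of_common_arc:
  assumes "directed_loop E L" "directed_loop E M" "single_valued A" "L \<subseteq> A" "M \<subseteq> A"
    and "a \<in> L" "a \<in> M"
  shows "L \<subseteq> M"
proof -
  obtain vs where vs: "2 \<le> length vs" "L = set (zip vs (rotate1 vs))"
    using assms(1) by (auto simp: directed_loop_def)
  define n where "n = length vs"
  define arc where "arc i = (vs ! (i mod n), vs ! (Suc i mod n))" for i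
  have n: "0 < n"
    using vs(1) unfolding n_def by linarith
  have L': "L = (\<lambda>i. (vs ! i, vs ! (Suc i mod n))) ` {..<n}"
    unfolding vs(2) n_def by (rule zip_rotate1_conv_nth)
  have L: "L = range arc"
  proof
    show "L \<subseteq> range arc"
      unfolding L' by (auto simp: arc_def intro!: image_eqI)
    show "range arc \<subseteq> L"
    proof
      fix a assume "a \<in> range arc"
      then obtain i where "a = arc i" by blast
      then show "a \<in> L"
        unfolding L' using n by (intro image_eqI[of _ _ "i mod n"]) (simp_all add: arc_def
          mod_Suc_eq)
    qed
  qed
  obtain ws where ws: "distinct ws" "M = (\<lambda>v. (v, cycle_of_list ws v)) ` set ws"
    using directed_loop_cycle[OF assms(2)] by metis
  have step: "arc (Suc i) \<in> M" if "arc i \<in> M" for i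
  proof -
    have "\<exists>v\<in>set ws. vs ! (Suc i mod n) = cycle_of_list ws v"
      using that unfolding arc_def ws(2) by blast
    then have "vs ! (Suc i mod n) \<in> set ws"
      using permutes_in_image[OF cycle_permutes[of ws]] by metis
    then have "(vs ! (Suc i mod n), cycle_of_list ws (vs ! (Suc i mod n))) \<in> A"
      using ws(2) assms(5) by blast
    moreover have "arc (Suc i) \<in> A"
      using L assms(4) by auto
    ultimately have "arc (Suc i) = (vs ! (Suc i mod n), cycle_of_list ws (vs ! (Suc i mod n)))"
      using assms(3) unfolding arc_def single_valued_def by blast
    then show ?thesis
      unfolding ws(2) using \<open>vs ! (Suc i mod n) \<in> set ws\<close> by blast
  qed
  obtain i where i: "a = arc i"
    using assms(6) L by auto
  have all: "arc (i + k) \<in> M" for k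
    by (induction k) (use i assms(7) step in auto)
  have "arc k \<in> M" for k
  proof -
    \<comment> \<open>Going around \<open>i\<close> times gives a multiple of \<open>n\<close> from
      which the starting index \<open>i\<close> can be subtracted in the naturals.\<close>
    have "i \<le> n * i"
      using n by simp
    then have "arc (i + (k + (n * i - i))) = arc (k + n * i)"
      by (intro arg_cong[of _ _ arc]) linarith
    also have "\<dots> = arc k"
      by (simp add: arc_def flip: add_Suc)
    finally show ?thesis
      using all by metis
  qed
  then show ?thesis
    using L by auto
qed

lemma md_config_eqI:
  assumes C: "md_config E C" and D: "md_config E D" and "\<Union>C = \<Union>D" "single_valued (\<Union>C)"
  shows "C = D"
proof -
  have "C \<subseteq> D" if C: "md_config E C" and D: "md_config E D" and eq: "\<Union>C = \<Union>D"
    and sv: "single_valued (\<Union>C)" for C D :: "('a \<times> 'a) set set"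
  proof
    fix L assume L: "L \<in> C"
    then have loop: "directed_loop E L"
      using C by (simp add: md_config_def)
    obtain cs where "2 \<le> length cs" "L = (\<lambda>v. (v, cycle_of_list cs v)) ` set cs"
      using directed_loop_cycle[OF loop] by metis
    then obtain a where a: "a \<in> L"
      by (cases cs) auto
    then obtain M where M: "M \<in> D" "a \<in> M"
      using L eq by blast
    then have loopM: "directed_loop E M"
      using D by (simp add: md_config_def)
    have sub: "L \<subseteq> \<Union>C" "M \<subseteq> \<Union>C"
      using L M eq by auto
    have "L \<subseteq> M" "M \<subseteq> L"
      using loop_subset_of_common_arc[OF loop loopM sv sub a M(2)]
        loop_subset_of_common_arc[OF loopM loop sv sub(2,1) M(2) a] by auto
    then show "L \<in> D"
      using M by simp
  qed
  from this[OF C D] this[OF D C] show ?thesis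
    using assms(3,4) by auto
qed

text \<open>Loops are added one at a time: composing with a cycle of even length on fresh vertices
  multiplies the sign by -1, which the minus sign in the hypothesis on \<open>W\<close>
  absorbs.\<close>

lemma md_config_permutation:
  fixes K :: "'v \<Rightarrow> 'v \<Rightarrow> real"
  assumes "finite C" "md_config E C" and W: "\<And>L. directed_loop E L \<Longrightarrow> W L = - (\<Prod>(u, v)\<in>L. K u v)"
  shows "\<exists>p. p permutes (\<Union>L\<in>C. loop_verts L) \<and> perm_arcs p = \<Union>C \<and>
    of_int (sign p) * (\<Prod>v\<in>(\<Union>L\<in>C. loop_verts L). K v (p v)) = (\<Prod>L\<in>C. W L)"
  using assms(1,2)
proof (induction C rule: finite_induct)
  case empty
  show ?case
    by (rule exI[of _ id]) (auto simp: perm_arcs_def permutes_id)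
next
  case (insert L C)
  let ?A = "\<Union>L\<in>C. loop_verts L"
  have conf: "md_config E C" and loop: "directed_loop E L"
    using insert.prems by (auto simp: md_config_def pairwise_insert)
  obtain p where p: "p permutes ?A" "perm_arcs p = \<Union>C"
    "of_int (sign p) * (\<Prod>v\<in>?A. K v (p v)) = (\<Prod>L\<in>C. W L)"
    using insert.IH[OF conf] by blast
  obtain cs where cs: "distinct cs" "2 \<le> length cs" "even (length cs)"
    "L = (\<lambda>v. (v, cycle_of_list cs v)) ` set cs" "loop_verts L = set cs"
    "perm_arcs (cycle_of_list cs) = L"
    using directed_loop_cycle[OF loop] by metis
  let ?q = "cycle_of_list cs"
  have q: "?q permutes set cs"
    by (rule cycle_permutes)
  have disj: "?A \<inter> set cs = {}"
  proof -
    have "disjnt (loop_verts L) (loop_verts M)" if "M \<in> C" for M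
      using insert that by (auto simp: md_config_def pairwise_insert)
    then show ?thesis
      using cs(5) by (fastforce simp: disjnt_def)
  qed
  have finA: "finite ?A"
  proof -
    have "finite (loop_verts M)" if "M \<in> C" for M
      using that conf directed_loop_cycle[of E M] unfolding md_config_def by (metis List.finite_set)
    then show ?thesis
      using insert.hyps by blast
  qed
  have val: "(?q \<circ> p) v = p v" if "v \<in> ?A" for v
  proof -
    have "p v \<in> ?A"
      using that by (simp only: permutes_in_image[OF p(1)])
    then have "p v \<notin> set cs"
      using disj by blast
    then show ?thesis
      by (simp add: id_outside_supp)
  qed
  have val': "(?q \<circ> p) v = ?q v" if "v \<in> set cs" for v
  proof -
    have "v \<notin> ?A"
      using that disj by blast
    then show ?thesis
      using permutes_not_in[OF p(1)] by simp
  qed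
  have un: "(\<Union>M\<in>insert L C. loop_verts M) = set cs \<union> ?A"
    by (simp add: cs(5))
  have "?q \<circ> p permutes set cs \<union> ?A"
    by (rule permutes_compose) (use p(1) q in \<open>auto intro: permutes_subset\<close>)
  moreover have "perm_arcs (?q \<circ> p) = \<Union>(insert L C)"
    using perm_arcs_disjoint_compose[OF p(1) q disj] cs p by simp
  moreover have "of_int (sign (?q \<circ> p)) * (\<Prod>v\<in>set cs \<union> ?A. K v ((?q \<circ> p) v)) = (\<Prod>L\<in>insert L C. W L)"
  proof -
    have "odd (length cs - 1)"
      using cs(2,3) by presburger
    then have sign_q: "sign ?q = -1"
      unfolding sign_cycle_of_list[OF cs(1)] by simp
    have sign: "sign (?q \<circ> p) = - sign p"
      unfolding sign_compose[OF permutation_of_cycle permutes_imp_permutation[OF finA p(1)]] sign_q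
      by simp
    have "(\<Prod>v\<in>set cs \<union> ?A. K v ((?q \<circ> p) v)) =
        (\<Prod>v\<in>set cs. K v ((?q \<circ> p) v)) * (\<Prod>v\<in>?A. K v ((?q \<circ> p) v))"
      by (rule prod.union_disjoint) (use finA disj in auto)
    also have "(\<Prod>v\<in>?A. K v ((?q \<circ> p) v)) = (\<Prod>v\<in>?A. K v (p v))"
      using val by (intro prod.cong) simp_all
    also have "(\<Prod>v\<in>set cs. K v ((?q \<circ> p) v)) = (\<Prod>v\<in>set cs. K v (?q v))"
      using val' by (intro prod.cong) simp_all
    also have "\<dots> = (\<Prod>(u, v)\<in>L. K u v)"
      unfolding cs(4) by (subst prod.reindex) (auto intro: inj_onI)
    also have "\<dots> = - W L"
      using W[OF loop] by simp
    finally have prod: "(\<Prod>v\<in>set cs \<union> ?A. K v ((?q \<circ> p) v)) = - W L * (\<Prod>v\<in>?A. K v (p v))" .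
    have "(\<Prod>L\<in>insert L C. W L) = W L * (of_int (sign p) * (\<Prod>v\<in>?A. K v (p v)))"
      unfolding p(3) by (rule prod.insert[OF insert.hyps])
    then show ?thesis
      unfolding sign prod by simp
  qed
  ultimately show ?case
    unfolding un by blast
qed

text \<open>The colour alternates along the list and must also change on the closing arc. This
  excludes the odd cycles, which permutations may have but configurations may not.\<close>

lemma bipartite_cycle_even:
  fixes col :: "'v \<Rightarrow> bool"
  assumes "2 \<le> length cs" "\<And>u v. (u, v) \<in> set (zip cs (rotate1 cs)) \<Longrightarrow> col u \<noteq> col v"
  shows "even (length cs)"
proof -
  have arc: "col (cs ! i) \<noteq> col (cs ! (Suc i mod length cs))" if "i < length cs" for i
    using that assms(2) by (auto simp: zip_rotate1_conv_nth)
  have col: "col (cs ! i) \<longleftrightarrow> (col (cs ! 0) \<longleftrightarrow> even i)" if "i < length cs" for i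
    using that
  proof (induction i)
    case (Suc i)
    then show ?case
      using arc[of i] by auto
  qed simp
  define k where "k = length cs - 1"
  have k: "length cs = Suc k"
    using assms(1) by (simp add: k_def)
  show ?thesis
    using arc[of k] col[of k] by (auto simp: k)
qed

lemma cycle_decomp_permutes: "cycle_decomp I p \<Longrightarrow> p permutes I"
proof (induction rule: cycle_decomp.induct)
  case (comp I p cs)
  show ?case
    by (rule permutes_compose)
       (use comp.IH cycle_permutes[of cs] in \<open>auto intro: permutes_subset\<close>)
qed (simp only: permutes_empty)

text \<open>Induction on the cycle decomposition: a cycle of length at least 2 is a new loop on
  fresh vertices, a shorter one is the identity.\<close>

lemma permutation_md_config:
  fixes col :: "'v \<Rightarrow> bool"
  assumes "cycle_decomp I p" and bip: "\<And>u v. {u, v} \<in> E \<Longrightarrow> col u \<noteq> col v"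
    and "\<And>v. p v = v \<or> {v, p v} \<in> E"
  shows "\<exists>C. md_config E C \<and> \<Union>C = perm_arcs p"
  using assms(1,3)
proof (induction rule: cycle_decomp.induct)
  case empty
  show ?case
    by (auto simp: md_config_def perm_arcs_def intro!: exI[of _ "{}"])
next
  case (comp I p cs)
  let ?q = "cycle_of_list cs"
  have q: "?q permutes set cs"
    by (rule cycle_permutes)
  have pp: "p permutes I"
    using comp.hyps(1) by (rule cycle_decomp_permutes)
  have pI: "p v = v" if "v \<notin> I" for v
    using permutes_not_in[OF pp that] .
  have p_in: "p v \<in> I" if "v \<in> I" for v
    using that by (simp only: permutes_in_image[OF pp])
  have E_p: "p v = v \<or> {v, p v} \<in> E" for v
  proof (cases "v \<in> I")
    case True
    then have "p v \<notin> set cs"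
      using p_in[OF True] comp.hyps(3) by blast
    then have "(?q \<circ> p) v = p v"
      by (simp add: id_outside_supp)
    then show ?thesis
      using comp.prems[of v] by simp
  qed (use pI in simp)
  then obtain C where C: "md_config E C" "\<Union>C = perm_arcs p"
    using comp.IH by blast
  have disj: "I \<inter> set cs = {}"
    using comp.hyps by blast
  have arcs: "perm_arcs (?q \<circ> p) = perm_arcs ?q \<union> perm_arcs p"
    by (rule perm_arcs_disjoint_compose[OF pp q disj])
  show ?case
  proof (cases "2 \<le> length cs")
    case False
    then have "?q = id"
      by (cases cs rule: cycle_of_list.cases) auto
    then show ?thesis
      using C by auto
  next
    case True
    define L where "L = set (zip cs (rotate1 cs))"
    have L: "L = (\<lambda>v. (v, ?q v)) ` set cs"
      using comp.hyps unfolding L_def by (simp add: zip_rotate1_eq_image)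
    have LE: "{u, v} \<in> E" if "(u, v) \<in> L" for u v
    proof -
      have u: "u \<in> set cs" "v = ?q u"
        using that L by auto
      then have "u \<notin> I"
        using disj by blast
      then have "(?q \<circ> p) u = ?q u"
        by (simp add: pI)
      then show ?thesis
        using comp.prems[of u] cycle_of_list_moves[OF comp.hyps(2) True u(1)] u(2) by auto
    qed
    then have loop: "directed_loop E L"
      unfolding directed_loop_def
      using bipartite_cycle_even[of cs col] bip comp.hyps True L_def by blast
    have "loop_verts L = set cs"
      using L by (force simp: loop_verts_def)
    moreover have "loop_verts M \<subseteq> I" if M: "M \<in> C" for M
    proof
      fix v assume "v \<in> loop_verts M"
      then obtain u where "(v, u) \<in> M"
        by (auto simp: loop_verts_def)
      then have "(v, u) \<in> \<Union>C"
        using M by blast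
      then show "v \<in> I"
        using C pI by (auto simp: perm_arcs_def)
    qed
    ultimately have "md_config E (insert L C)"
      using C(1) loop disj unfolding md_config_def pairwise_insert
      by (auto simp: disjnt_def)
    moreover have "perm_arcs ?q = L"
      unfolding L using cycle_of_list_moves[OF comp.hyps(2) True] id_outside_supp[of _ cs]
      by (fastforce simp: perm_arcs_def)
    ultimately have "md_config E (insert L C) \<and> \<Union>(insert L C) = perm_arcs (?q \<circ> p)"
      using C(2) arcs by (simp only: Union_insert simp_thms)
    then show ?thesis
      by blast
  qed
qed

text \<open>The union of its arcs identifies a configuration with a permutation that moves vertices
  only along edges; every other permutation meets a zero entry of \<open>K\<close>.\<close>

theorem md_sum_eq_permutation_sum:
  fixes K :: "'v \<Rightarrow> 'v \<Rightarrow> real" and col :: "'v \<Rightarrow> bool"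
  assumes V: "finite V" "\<Union>E \<subseteq> V"
    and bip: "\<And>u v. {u, v} \<in> E \<Longrightarrow> col u \<noteq> col v"
    and K0: "\<And>u v. u \<in> V \<Longrightarrow> v \<in> V \<Longrightarrow> u \<noteq> v \<Longrightarrow> {u, v} \<notin> E \<Longrightarrow> K u v = 0"
    and W: "\<And>L. directed_loop E L \<Longrightarrow> W L = - (\<Prod>(u, v)\<in>L. K u v)"
  shows "(\<Sum>C | md_config E C. (\<Prod>L\<in>C. W L) * (\<Prod>v\<in>V - (\<Union>L\<in>C. loop_verts L). K v v)) =
    (\<Sum>p | p permutes V. of_int (sign p) * (\<Prod>v\<in>V. K v (p v)))"
proof -
  define good where "good = {p. p permutes V \<and> (\<forall>v. p v = v \<or> {v, p v} \<in> E)}"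
  let ?term = "\<lambda>p. of_int (sign p) * (\<Prod>v\<in>V. K v (p v))"
  let ?weight = "\<lambda>C. (\<Prod>L\<in>C. W L) * (\<Prod>v\<in>V - (\<Union>L\<in>C. loop_verts L). K v v)"
  have fin: "finite C" if "md_config E C" for C
  proof -
    have "C \<subseteq> Pow (V \<times> V)"
    proof (intro subsetI PowI)
      fix L a assume "L \<in> C" "a \<in> L"
      then have "{fst a, snd a} \<in> E"
        using that by (auto simp: md_config_def directed_loop_def case_prod_beta)
      then show "a \<in> V \<times> V"
        using V(2) by (cases a) auto
    qed
    then show ?thesis
      using V(1) by (meson finite_Pow_iff finite_SigmaI finite_subset)
  qed
  have ex: "\<exists>p. p \<in> good \<and> perm_arcs p = \<Union>C \<and> ?term p = ?weight C" if C: "md_config E C" for C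
  proof -
    let ?A = "\<Union>L\<in>C. loop_verts L"
    obtain p where p: "p permutes ?A" "perm_arcs p = \<Union>C"
      "of_int (sign p) * (\<Prod>v\<in>?A. K v (p v)) = (\<Prod>L\<in>C. W L)"
      using md_config_permutation[OF fin[OF C] C W] by blast
    have E: "p v = v \<or> {v, p v} \<in> E" for v
    proof (cases "p v = v")
      case False
      then have "(v, p v) \<in> \<Union>C"
        using p(2) by (auto simp: perm_arcs_def)
      then show ?thesis
        using C by (auto simp: md_config_def directed_loop_def)
    qed simp
    have AV: "?A \<subseteq> V"
    proof
      fix v assume "v \<in> ?A"
      then obtain M u where "M \<in> C" "(v, u) \<in> M"
        by (auto simp: loop_verts_def)
      then have "{v, u} \<in> E"
        using C by (auto simp: md_config_def directed_loop_def)
      then show "v \<in> V"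
        using V(2) by auto
    qed
    then have "p permutes V"
      using p(1) by (rule permutes_subset[rotated])
    moreover have "?term p = ?weight C"
    proof -
      have "(\<Prod>v\<in>V. K v (p v)) = (\<Prod>v\<in>V - ?A. K v (p v)) * (\<Prod>v\<in>?A. K v (p v))"
        by (rule prod.subset_diff[OF AV V(1)])
      also have "(\<Prod>v\<in>V - ?A. K v (p v)) = (\<Prod>v\<in>V - ?A. K v v)"
        using permutes_not_in[OF p(1)] by (intro prod.cong) auto
      finally show ?thesis
        unfolding p(3)[symmetric] by (simp add: mult_ac)
    qed
    ultimately show ?thesis
      using p E by (auto simp: good_def)
  qed
  define G where "G C = (SOME p. p \<in> good \<and> perm_arcs p = \<Union>C \<and> ?term p = ?weight C)" for C
  have G: "G C \<in> good" "perm_arcs (G C) = \<Union>C" "?term (G C) = ?weight C" if "md_config E C" for C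
    using someI_ex[OF ex[OF that]] unfolding G_def by blast+
  have sv: "single_valued (perm_arcs p)" for p :: "'v \<Rightarrow> 'v"
    by (auto simp: perm_arcs_def single_valued_def)
  have "bij_betw G {C. md_config E C} good"
  proof (rule bij_betw_imageI)
    show "inj_on G {C. md_config E C}"
      using md_config_eqI G(2) sv unfolding inj_on_def by (metis mem_Collect_eq)
    show "G ` {C. md_config E C} = good"
    proof
      show "good \<subseteq> G ` {C. md_config E C}"
      proof
        fix p assume p: "p \<in> good"
        have "cycle_decomp V p"
          using p V(1) by (intro cycle_decomposition) (auto simp: good_def)
        then obtain C where C: "md_config E C" "\<Union>C = perm_arcs p"
          using permutation_md_config[of V p E col] bip p by (auto simp: good_def)
        then have "p = G C"
          using perm_arcs_inj G(2) by metis
        then show "p \<in> G ` {C. md_config E C}"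
          using C by blast
      qed
    qed (use G in auto)
  qed
  then have "(\<Sum>p\<in>good. ?term p) = (\<Sum>C | md_config E C. ?term (G C))"
    by (rule sum.reindex_bij_betw[symmetric])
  also have "\<dots> = (\<Sum>C | md_config E C. ?weight C)"
    using G(3) by (intro sum.cong) auto
  also have "(\<Sum>p\<in>good. ?term p) = (\<Sum>p | p permutes V. ?term p)"
  proof (rule sum.mono_neutral_left)
    show "finite {p. p permutes V}"
      using V(1) by (rule finite_permutations)
    show "\<forall>p\<in>{p. p permutes V} - good. ?term p = 0"
    proof
      fix p assume p: "p \<in> {p. p permutes V} - good"
      then obtain v where v: "p v \<noteq> v" "{v, p v} \<notin> E"
        by (auto simp: good_def)
      have "p permutes V"
        using p by simp
      then have "v \<in> V" "p v \<in> V"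
        using v(1) permutes_not_in permutes_in_image by metis+
      moreover from this have "K v (p v) = 0"
        using K0 v by metis
      ultimately have "(\<Prod>v\<in>V. K v (p v)) = 0"
        by (intro prod_zero[OF V(1)] bexI[of _ v])
      then show "?term p = 0"
        by simp
    qed
  qed (auto simp: good_def)
  finally show ?thesis
    by simp
qed

section \<open>The determinant of the Kasteleyn matrix\<close>

text \<open>Indexing by an arbitrary set lets grid vertices serve as rows and columns; an
  enumeration of the set transfers the product and transpose rules from matrices.\<close>

definition leibniz_det :: "'v set \<Rightarrow> ('v \<Rightarrow> 'v \<Rightarrow> real) \<Rightarrow> real" where
  "leibniz_det V A = (\<Sum>p | p permutes V. of_int (sign p) * (\<Prod>v\<in>V. A v (p v)))"

lemma leibniz_det_cong:
  assumes "\<And>u v. u \<in> V \<Longrightarrow> v \<in> V \<Longrightarrow> A u v = B u v"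
  shows "leibniz_det V A = leibniz_det V B"
  unfolding leibniz_det_def
proof (intro sum.cong refl arg_cong2[of _ _ _ _ "(*)"] prod.cong)
  fix p v assume "p \<in> {p. p permutes V}" "v \<in> V"
  then show "A v (p v) = B v (p v)"
    using assms permutes_in_image[of p V v] by simp
qed

lemma leibniz_det_eq_det:
  assumes "bij_betw h {0..<N} V"
  shows "leibniz_det V A = Determinant.det (Matrix.mat N N (\<lambda>(i, j). A (h i) (h j)))"
proof -
  let ?h' = "inv_into {0..<N} h"
  have h': "bij_betw ?h' V {0..<N}"
    using assms by (rule bij_betw_inv_into)
  have inj: "inj_on h {0..<N}"
    using assms by (rule bij_betw_imp_inj_on)
  have "leibniz_det V A = (\<Sum>p | p permutes {0..<N}. of_int (sign p) * (\<Prod>i =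
    0..<N. A (h i) (h (p i))))"
    unfolding leibniz_det_def
  proof (rule sum.reindex_bij_witness[of _ "map_permutation {0..<N} h" "map_permutation V ?h'"])
    fix q assume "q \<in> {q. q permutes V}"
    then have q: "q permutes V" by simp
    show "map_permutation {0..<N} h (map_permutation V ?h' q) = q"
      by (rule map_permutation_compose_inv[OF h' q]) (use assms in \<open>auto simp:
        bij_betw_inv_into_right\<close>)
    show perm: "map_permutation V ?h' q \<in> {p. p permutes {0..<N}}"
      using map_permutation_permutes[OF h' q] by simp
    have "h (map_permutation V ?h' q i) = q (h i)" if "i \<in> {0..<N}" for i
    proof -
      have hi: "h i \<in> V" "?h' (h i) = i"
        using that assms inj by (auto simp: bij_betw_def)
      have "map_permutation V ?h' q (?h' (h i)) = ?h' (q (h i))"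
        using h' hi by (intro map_permutation_apply) (auto simp: bij_betw_def)
      then show ?thesis
        using hi q assms by (simp add: bij_betw_inv_into_right permutes_in_image)
    qed
    then have "(\<Prod>i = 0..<N. A (h i) (h (map_permutation V ?h' q i))) = (\<Prod>i =
      0..<N. A (h i) (q (h i)))"
      by (intro prod.cong) auto
    also have "\<dots> = (\<Prod>v\<in>V. A v (q v))"
      by (rule prod.reindex_bij_betw[OF assms])
    finally show "of_int (sign (map_permutation V ?h' q)) *
        (\<Prod>i = 0..<N. A (h i) (h (map_permutation V ?h' q i))) =
        of_int (sign q) * (\<Prod>v\<in>V. A v (q v))"
      using h' q assms bij_betw_finite[OF assms] by (simp add: sign_map_permutation bij_betw_def)
  next
    fix p assume "p \<in> {p. p permutes {0..<N}}"
    then have p: "p permutes {0..<N}" by simp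
    show "map_permutation V ?h' (map_permutation {0..<N} h p) = p"
      by (rule map_permutation_compose_inv[OF assms p]) (use inj in auto)
    show "map_permutation {0..<N} h p \<in> {q. q permutes V}"
      using map_permutation_permutes[OF assms p] by simp
  qed
  also have "\<dots> = Determinant.det (Matrix.mat N N (\<lambda>(i, j). A (h i) (h j)))"
  proof -
    have "p i < N" if "p permutes {0..<N}" "i < N" for p i
      using permutes_in_image[OF that(1), of i] that(2) by simp
    then show ?thesis
      by (subst det_def'[of _ N]) (auto intro!: sum.cong prod.cong)
  qed
  finally show ?thesis .
qed

lemma leibniz_det_mult:
  assumes "finite V"
  shows "leibniz_det V (\<lambda>u v. \<Sum>w\<in>V. A u w * B w v) = leibniz_det V A * leibniz_det V B"
proof -
  obtain h where h: "bij_betw h {0..<card V} V"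
    using ex_bij_betw_nat_finite[OF assms] by blast
  let ?M = "\<lambda>A. Matrix.mat (card V) (card V) (\<lambda>(i, j). A (h i) (h j) :: real)"
  have "(\<Sum>w\<in>V. A (h i) w * B w (h j)) = (\<Sum>k = 0..<card V. A (h i) (h k) * B (h k) (h j))" for i j
    by (rule sum.reindex_bij_betw[OF h, symmetric])
  then have "?M (\<lambda>u v. \<Sum>w\<in>V. A u w * B w v) = ?M A * ?M B"
    by (intro eq_matI) (simp_all add: scalar_prod_def)
  then show ?thesis
    unfolding leibniz_det_eq_det[OF h] by (simp add: det_mult[of _ "card V"])
qed

lemma leibniz_det_transpose:
  assumes "finite V"
  shows "leibniz_det V (\<lambda>u v. A v u) = leibniz_det V A"
proof -
  obtain h where h: "bij_betw h {0..<card V} V"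
    using ex_bij_betw_nat_finite[OF assms] by blast
  let ?M = "\<lambda>A. Matrix.mat (card V) (card V) (\<lambda>(i, j). A (h i) (h j) :: real)"
  have "?M (\<lambda>u v. A v u) = transpose_mat (?M A)"
    by (intro eq_matI) simp_all
  then show ?thesis
    unfolding leibniz_det_eq_det[OF h] by (simp add: det_transpose[of _ "card V"])
qed

lemma leibniz_det_diag:
  assumes "finite V"
  shows "leibniz_det V (\<lambda>u v. if u = v then d v else 0) = (\<Prod>v\<in>V. d v)"
proof -
  let ?f = "\<lambda>p. of_int (sign p) * (\<Prod>v\<in>V. if v = p v then d (p v) else 0) :: real"
  have zero: "?f p = 0" if p: "p permutes V" "p \<noteq> id" for p
  proof -
    obtain v where v: "p v \<noteq> v"
      using p(2) by (auto simp: fun_eq_iff)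
    then have "v \<in> V"
      using p(1) permutes_not_in by metis
    then have "(\<Prod>v\<in>V. if v = p v then d (p v) else 0) = 0"
      using v by (intro prod_zero[OF assms] bexI[of _ v]) auto
    then show ?thesis
      by simp
  qed
  have "leibniz_det V (\<lambda>u v. if u = v then d v else 0) = (\<Sum>p\<in>{id}. ?f p)"
    unfolding leibniz_det_def
    by (rule sum.mono_neutral_right) (use assms zero in \<open>auto simp: finite_permutations
      permutes_id\<close>)
  then show ?thesis
    by simp
qed

section \<open>The Kasteleyn matrix and its spectrum\<close>

definition kasteleyn :: "real \<Rightarrow> real \<Rightarrow> real \<Rightarrow> nat \<times> nat \<Rightarrow> nat \<times> nat \<Rightarrow> real" where
  "kasteleyn a b z u v =
     z * of_bool (v = u)
     + b * (of_bool (u = (fst v + 1, snd v)) - of_bool (v = (fst u + 1, snd u)))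
     + (-1) ^ fst u * a * (of_bool (v = (fst u, snd u + 1)) - of_bool (u = (fst v, snd v + 1)))"

text \<open>The off-diagonal part is skew and linear in \<open>(a, b)\<close>, so the transpose is
  given by the same stencil with negated weights.\<close>

lemma kasteleyn_transpose: "kasteleyn (- a) (- b) z u v = kasteleyn a b z v u"
  by (cases "fst u = fst v") (auto simp: kasteleyn_def prod_eq_iff)

lemma sum_delta_mult:
  fixes f :: "'v \<Rightarrow> real"
  assumes "finite V" "w \<notin> V \<Longrightarrow> f w = 0"
  shows "(\<Sum>v\<in>V. of_bool (v = w) * f v) = f w"
proof -
  have "(\<Sum>v\<in>V. of_bool (v = w) * f v) = (\<Sum>v\<in>V. if v = w then f v else 0)"
    by (intro sum.cong) auto
  also have "\<dots> = f w"
    using assms by (simp add: sum.delta)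
  finally show ?thesis .
qed

text \<open>Neighbours outside the grid enter with value 0, so no boundary cases remain. Vanishing
  is asked only on the frame at 0, \<open>m + 1\<close> and \<open>n + 1\<close>, which is what the
  sine modes provide.\<close>

lemma kasteleyn_stencil:
  assumes ij: "(i, j) \<in> grid_verts m n"
    and f0: "\<And>v. v \<notin> grid_verts m n \<Longrightarrow> fst v \<le> m + 1 \<Longrightarrow> snd v \<le> n + 1 \<Longrightarrow> f v = 0"
  shows "(\<Sum>v\<in>grid_verts m n. kasteleyn a b z (i, j) v * f v) =
    z * f (i, j) + b * (f (i - 1, j) - f (i + 1, j)) + (-1) ^ i * a * (f (i, j + 1) - f (i, j - 1))"
proof -
  let ?V = "grid_verts m n"
  have fin: "finite ?V"
    by (simp add: grid_verts_def)
  have ij': "1 \<le> i" "i \<le> m" "1 \<le> j" "j \<le> n"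
    using ij by (auto simp: grid_verts_def)
  have "kasteleyn a b z (i, j) v * f v =
      z * (of_bool (v = (i, j)) * f v)
      + b * (of_bool (v = (i - 1, j)) * f v - of_bool (v = (i + 1, j)) * f v)
      + (-1) ^ i * a * (of_bool (v = (i, j + 1)) * f v - of_bool (v = (i, j - 1)) * f v)" for v
  proof -
    have "(i, j) = (fst v + 1, snd v) \<longleftrightarrow> v = (i - 1, j)" "(i, j) = (fst v, snd v + 1) \<longleftrightarrow> v = (i,
      j - 1)"
      using ij' by (auto simp: prod_eq_iff)
    then show ?thesis
      by (simp add: kasteleyn_def algebra_simps)
  qed
  then have "(\<Sum>v\<in>?V. kasteleyn a b z (i, j) v * f v) =
      z * (\<Sum>v\<in>?V. of_bool (v = (i, j)) * f v)
      + b * ((\<Sum>v\<in>?V. of_bool (v = (i - 1, j)) * f v) - (\<Sum>v\<in>?V. of_bool (v = (i + 1, j)) * f v))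
      + (-1) ^ i * a * ((\<Sum>v\<in>?V. of_bool (v = (i, j + 1)) * f v) - (\<Sum>v\<in>?V. of_bool (v = (i,
        j - 1)) * f v))"
    by (simp only: sum.distrib sum_subtractf sum_distrib_left[symmetric])
  also have "(\<Sum>v\<in>?V. of_bool (v = (i, j)) * f v) = f (i, j)"
    by (rule sum_delta_mult[OF fin]) (use ij in simp)
  also have "(\<Sum>v\<in>?V. of_bool (v = (i - 1, j)) * f v) = f (i - 1, j)"
    by (rule sum_delta_mult[OF fin], rule f0) (use ij' in auto)
  also have "(\<Sum>v\<in>?V. of_bool (v = (i + 1, j)) * f v) = f (i + 1, j)"
    by (rule sum_delta_mult[OF fin], rule f0) (use ij' in auto)
  also have "(\<Sum>v\<in>?V. of_bool (v = (i, j + 1)) * f v) = f (i, j + 1)"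
    by (rule sum_delta_mult[OF fin], rule f0) (use ij' in auto)
  also have "(\<Sum>v\<in>?V. of_bool (v = (i, j - 1)) * f v) = f (i, j - 1)"
    by (rule sum_delta_mult[OF fin], rule f0) (use ij' in auto)
  finally show ?thesis .
qed

text \<open>
  Conjugation by powers of the imaginary unit turns the skew tridiagonal matrix into the adjacency
  matrix of a path. Kept real, this gives two sine modes with signs of period 4 that the skew
  matrix interchanges; \<open>sine_mode\<close> is indexed by \<open>s\<close> modulo 2 up to sign.
\<close>

definition quarter_sign :: "nat \<Rightarrow> real" where
  "quarter_sign i = (-1) ^ (i div 2)"

lemma quarter_sign_add2: "quarter_sign (i + 2) = - quarter_sign i"
  by (simp add: quarter_sign_def)

lemma quarter_sign_sq: "quarter_sign i * quarter_sign i = 1"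
  by (simp add: quarter_sign_def flip: power_mult_distrib)

definition sine_mode :: "nat \<Rightarrow> nat \<Rightarrow> nat \<Rightarrow> nat \<Rightarrow> real" where
  "sine_mode s m k i = quarter_sign (i + s) * sin (real i * (pi * real k / real (m + 1)))"

definition mode_eig :: "nat \<Rightarrow> nat \<Rightarrow> real" where
  "mode_eig m k = 2 * cos (pi * real k / real (m + 1))"

text \<open>\<open>quarter_sign\<close> has opposite values at distance 2, which turns the
  difference of neighbours into a sum of sines at angles \<open>i * t + t\<close> and
  \<open>i * t - t\<close>.\<close>

lemma sine_mode_diff:
  assumes "1 \<le> i"
  shows "sine_mode s m k (i + 1) - sine_mode s m k (i - 1) = mode_eig m k * sine_mode (s + 1) m k i"
proof -
  obtain l where l: "i = Suc l"
    using assms by (cases i) auto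
  let ?t = "pi * real k / real (m + 1)"
  have 1: "sin (real (i + 1) * ?t) = sin (real i * ?t + ?t)" "sin (real (i - 1) * ?t) =
    sin (real i * ?t - ?t)"
    by (simp_all add: l algebra_simps add_divide_distrib)
  have 2: "quarter_sign (i + 1 + s) = quarter_sign (i + (s + 1))" "quarter_sign (i - 1 + s) =
    - quarter_sign (i + (s + 1))"
    using quarter_sign_add2[of "l + s"] by (simp_all add: l)
  show ?thesis
    unfolding sine_mode_def 1 2 mode_eig_def sin_add sin_diff by (simp add: algebra_simps)
qed

lemma sine_mode_shift2: "sine_mode (s + 2) m k i = - sine_mode s m k i"
  using quarter_sign_add2[of "i + s"] by (simp add: sine_mode_def add.assoc)

lemma sine_mode_boundary: "sine_mode s m k 0 = 0" "sine_mode s m k (m + 1) = 0"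
proof -
  have "real (m + 1) * (pi * real k / real (m + 1)) = real k * pi"
    by (simp add: field_simps)
  then show "sine_mode s m k (m + 1) = 0"
    unfolding sine_mode_def by (simp only: sin_npi mult_zero_right)
qed (simp add: sine_mode_def)

definition grid_eig :: "nat \<Rightarrow> nat \<Rightarrow> real \<Rightarrow> real \<Rightarrow> real \<Rightarrow> nat \<times> nat \<Rightarrow> real" where
  "grid_eig m n a b z k = z\<^sup>2 + b\<^sup>2 * (mode_eig m (fst k))\<^sup>2 + a\<^sup>2 * (mode_eig n (snd k))\<^sup>2"

definition grid_mode :: "nat \<Rightarrow> nat \<Rightarrow> nat \<times> nat \<Rightarrow> nat \<times> nat \<Rightarrow> real" where
  "grid_mode m n u k = sine_mode 0 m (fst k) (fst u) * sine_mode 0 n (snd k) (snd u)"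

text \<open>\<open>G\<close> is the transpose applied to the mode. After the second application the
  terms linear in \<open>z\<close> cancel by skewness, and the mixed terms in \<open>a * b\<close>
  cancel because the column sign \<open>(-1) ^ i\<close> flips under a horizontal shift.\<close>

lemma kasteleyn_kasteleyn_transpose_mode:
  assumes u: "u \<in> grid_verts m n"
  shows "(\<Sum>w\<in>grid_verts m n. kasteleyn a b z u w *
      (\<Sum>v\<in>grid_verts m n. kasteleyn (- a) (- b) z w v * grid_mode m n v k)) =
    grid_eig m n a b z k * grid_mode m n u k"
proof -
  let ?V = "grid_verts m n"
  define p p' where "p = sine_mode 0 m (fst k)" and "p' = sine_mode 1 m (fst k)"
  define q q' where "q = sine_mode 0 n (snd k)" and "q' = sine_mode 1 n (snd k)"
  define c d where "c = mode_eig m (fst k)" and "d = mode_eig n (snd k)"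
  note defs = p_def p'_def q_def q'_def c_def d_def
  have p: "p (i + 1) - p (i - 1) = c * p' i" "p' (i + 1) - p' (i - 1) = - c * p i" if "1 \<le> i" for i
    using sine_mode_diff[OF that, of _ m "fst k"] sine_mode_shift2[of 0 m "fst k" i]
    by (simp_all add: defs numeral_2_eq_2)
  have q: "q (i + 1) - q (i - 1) = d * q' i" "q' (i + 1) - q' (i - 1) = - d * q i" if "1 \<le> i" for i
    using sine_mode_diff[OF that, of _ n "snd k"] sine_mode_shift2[of 0 n "snd k" i]
    by (simp_all add: defs numeral_2_eq_2)
  have bd: "p 0 = 0" "p' 0 = 0" "q 0 = 0" "q' 0 = 0" "p (m + 1) = 0" "p' (m + 1) = 0"
    "q (n + 1) = 0" "q' (n + 1) = 0"
    by (simp_all only: defs sine_mode_boundary)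
  have boundary: "fst v = 0 \<or> fst v = m + 1 \<or> snd v = 0 \<or> snd v = n + 1"
    if "v \<notin> ?V" "fst v \<le> m + 1" "snd v \<le> n + 1" for v
    using that by (cases v) (auto simp: grid_verts_def)
  define G where "G v = z * (p (fst v) * q (snd v)) + b * c * (p' (fst v) * q (snd v))
      - (-1) ^ fst v * a * d * (p (fst v) * q' (snd v))" for v
  have inner: "(\<Sum>v\<in>?V. kasteleyn (- a) (- b) z w v * grid_mode m n v k) = G w" if w: "w \<in> ?V" for w
  proof -
    obtain i j where ij: "w = (i, j)" by fastforce
    have pos: "1 \<le> i" "1 \<le> j"
      using w ij by (auto simp: grid_verts_def)
    have mode: "grid_mode m n v k = p (fst v) * q (snd v)" for v
      by (simp add: grid_mode_def defs)
    have "(\<Sum>v\<in>?V. kasteleyn (- a) (- b) z (i, j) v * (p (fst v) * q (snd v))) =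
      z * (p i * q j) + - b * (p (i - 1) * q j - p (i + 1) * q j)
      + (-1) ^ i * - a * (p i * q (j + 1) - p i * q (j - 1))"
      by (subst kasteleyn_stencil) (use w ij boundary bd in \<open>auto dest!: boundary\<close>)
    also have "\<dots> = z * (p i * q j) + b * ((p (i + 1) - p (i - 1)) * q j)
      - (-1) ^ i * a * (p i * (q (j + 1) - q (j - 1)))"
      by (simp add: algebra_simps)
    also have "\<dots> = G w"
      unfolding p(1)[OF pos(1)] q(1)[OF pos(2)] by (simp add: G_def ij)
    finally show ?thesis
      by (simp add: mode ij)
  qed
  obtain i j where ij: "u = (i, j)" by fastforce
  have pos: "1 \<le> i" "1 \<le> j"
    using u ij by (auto simp: grid_verts_def)
  have sgn: "(-1) ^ (i + 1) = - ((-1) ^ i :: real)" "(-1) ^ (i - 1) = - ((-1) ^ i :: real)"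
    using pos(1) by (cases i; simp)+
  have sq: "(-1) ^ i * ((-1) ^ i * t) = t" for t :: real
    by (simp add: power_mult_distrib[symmetric] flip: mult.assoc)
  have "(\<Sum>w\<in>?V. kasteleyn a b z u w * (\<Sum>v\<in>?V. kasteleyn (- a) (- b) z w v * grid_mode m n v k)) =
      (\<Sum>w\<in>?V. kasteleyn a b z (i, j) w * G w)"
    using inner by (intro sum.cong) (simp_all add: ij)
  also have "\<dots> = z * G (i, j) + b * (G (i - 1, j) - G (i + 1, j)) + (-1) ^ i * a * (G (i, j +
    1) - G (i, j - 1))"
  proof (rule kasteleyn_stencil)
    fix v assume "v \<notin> ?V" "fst v \<le> m + 1" "snd v \<le> n + 1"
    from boundary[OF this] show "G v = 0"
      using bd by (auto simp: G_def)
  qed (use u ij in simp)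
  also have "G (i - 1, j) - G (i + 1, j) = - z * ((p (i + 1) - p (i - 1)) * q j)
      - b * c * ((p' (i + 1) - p' (i - 1)) * q j) - (-1) ^ i * a * d * ((p (i + 1) - p (i - 1)) *
        q' j)"
    unfolding G_def fst_conv snd_conv sgn by (simp add: algebra_simps)
  also have "\<dots> = - z * c * (p' i * q j) + b * c * c * (p i * q j) - (-1) ^ i * a * d * c * (p' i *
    q' j)"
    unfolding p[OF pos(1)] by (simp add: algebra_simps)
  also have "G (i, j + 1) - G (i, j - 1) = z * (p i * (q (j + 1) - q (j - 1)))
      + b * c * (p' i * (q (j + 1) - q (j - 1))) - (-1) ^ i * a * d * (p i * (q' (j +
        1) - q' (j - 1)))"
    unfolding G_def fst_conv snd_conv by (simp add: algebra_simps)
  also have "\<dots> = z * d * (p i * q' j) + b * c * d * (p' i * q' j) + (-1) ^ i * a * d * d * (p i *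
    q j)"
    unfolding q[OF pos(2)] by (simp add: algebra_simps)
  also have "z * G (i, j) + b * (- z * c * (p' i * q j) + b * c * c * (p i * q j) - (-1) ^ i * a *
    d * c * (p' i * q' j))
      + (-1) ^ i * a * (z * d * (p i * q' j) + b * c * d * (p' i * q' j) + (-1) ^ i * a * d * d *
        (p i * q j)) =
      z * z * (p i * q j) + b * b * c * c * (p i * q j) + (-1) ^ i * ((-1) ^ i * (a * a * d * d *
        (p i * q j)))"
    unfolding G_def fst_conv snd_conv by (simp add: algebra_simps)
  also have "\<dots> = grid_eig m n a b z k * grid_mode m n u k"
    unfolding sq by (simp add: grid_eig_def grid_mode_def ij power2_eq_square algebra_simps flip:
      defs)
  finally show ?thesis .
qed

text \<open>Multiplying by \<open>2 * sin (t / 2)\<close> telescopes the sum, and the bound on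
  \<open>r\<close> keeps this factor nonzero. The value is 1 for odd and 0 for even
  \<open>r\<close>.\<close>

lemma sum_cos_multiples:
  fixes r :: int
  assumes "r \<noteq> 0" "\<bar>r\<bar> < 2 * int M"
  shows "(\<Sum>i<M. cos (real i * (pi * of_int r / real M))) = (1 - cos (of_int r * pi)) / 2"
proof -
  define t where "t = pi * of_int r / real M"
  have M: "0 < M"
    using assms by (cases M) auto
  have nz: "sin (t / 2) \<noteq> 0"
  proof
    assume "sin (t / 2) = 0"
    then obtain l :: int where "t / 2 = of_int l * pi"
      by (auto simp: sin_zero_iff_int2)
    then have "of_int r = (of_int (2 * int M * l) :: real)"
      using M by (simp add: t_def field_simps)
    then have "r = 2 * int M * l"
      by (simp only: of_int_eq_iff)
    then have "2 * int M dvd r"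
      by simp
    then show False
      using assms zdvd_not_zless[of "\<bar>r\<bar>" "2 * int M"] by simp
  qed
  have "2 * sin (t / 2) * (\<Sum>i<M. cos (real i * t)) =
      (\<Sum>i<M. sin (real (Suc i) * t - t / 2) - sin (real i * t - t / 2))"
    unfolding sum_distrib_left
  proof (intro sum.cong refl)
    fix i
    have "real (Suc i) * t - t / 2 = real i * t + t / 2"
      by (simp add: algebra_simps)
    then show "2 * sin (t / 2) * cos (real i * t) = sin (real (Suc i) * t - t / 2) - sin (real i *
      t - t / 2)"
      by (simp add: sin_add sin_diff)
  qed
  also have "\<dots> = sin (real M * t - t / 2) - sin (0 - t / 2)"
    by (subst sum_lessThan_telescope) simp
  also have "real M * t = of_int r * pi"
    using M by (simp add: t_def)
  also have "sin (of_int r * pi - t / 2) - sin (0 - t / 2) = sin (t / 2) * (1 - cos (of_int r *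
    pi))"
    by (simp add: sin_diff sin_int_times_real algebra_simps)
  finally have "sin (t / 2) * (2 * (\<Sum>i<M. cos (real i * t))) = sin (t / 2) * (1 - cos (of_int r *
    pi))"
    by (simp add: algebra_simps)
  then show ?thesis
    using nz by (simp add: t_def)
qed

text \<open>For \<open>k \<noteq> l\<close> the numbers \<open>k - l\<close> and
  \<open>k + l\<close> have equal parity, so their cosine sums cancel; for \<open>k = l\<close> the
  sums are \<open>m + 1\<close> and 0.\<close>

lemma sine_mode_orthogonal:
  assumes "k \<in> {1..m}" "l \<in> {1..m}"
  shows "(\<Sum>i\<in>{1..m}. sine_mode 0 m k i * sine_mode 0 m l i) = (if k = l then real (m +
    1) / 2 else 0)"
proof -
  define C where "C r = (\<Sum>i<m + 1. cos (real i * (pi * of_int r / real (m + 1))))" for r :: int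
  have "(\<Sum>i\<in>{1..m}. sine_mode 0 m k i * sine_mode 0 m l i) =
      (\<Sum>i\<in>{1..m}. sin (real i * (pi * real k / real (m + 1))) * sin (real i * (pi *
        real l / real (m + 1))))"
    by (intro sum.cong) (auto simp: sine_mode_def quarter_sign_sq mult_ac simp flip: mult.assoc[of
      "quarter_sign _" "quarter_sign _"])
  also have "\<dots> = (\<Sum>i<m + 1. sin (real i * (pi * real k / real (m + 1))) * sin (real i * (pi *
    real l / real (m + 1))))"
    by (rule sum.mono_neutral_left) (auto simp: not_le Suc_le_eq)
  also have "\<dots> = (\<Sum>i<m + 1. (cos (real i * (pi * of_int (int k - int l) / real (m + 1)))
      - cos (real i * (pi * of_int (int k + int l) / real (m + 1)))) / 2)"
  proof (intro sum.cong refl)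
    fix i
    have "real i * (pi * of_int (int k - int l) / real (m + 1)) =
        real i * (pi * real k / real (m + 1)) - real i * (pi * real l / real (m + 1))"
      "real i * (pi * of_int (int k + int l) / real (m + 1)) =
        real i * (pi * real k / real (m + 1)) + real i * (pi * real l / real (m + 1))"
      by (simp_all add: algebra_simps add_divide_distrib diff_divide_distrib)
    then show "sin (real i * (pi * real k / real (m + 1))) * sin (real i * (pi *
      real l / real (m + 1))) =
       (cos (real i * (pi * of_int (int k - int l) / real (m + 1)))
        - cos (real i * (pi * of_int (int k + int l) / real (m + 1)))) / 2"
      by (simp only: sin_times_sin)
  qed
  also have "\<dots> = (C (int k - int l) - C (int k + int l)) / 2"
    by (simp only: C_def sum_subtractf sum_divide_distrib[symmetric])
  also have "\<dots> = (if k = l then real (m + 1) / 2 else 0)"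
  proof -
    have plus: "C (int k + int l) = (1 - cos (of_int (int k + int l) * pi)) / 2"
      unfolding C_def by (rule sum_cos_multiples) (use assms in auto)
    show ?thesis
    proof (cases "k = l")
      case True
      have "cos (of_int (int l + int l) * pi) = 1"
        using cos_2npi[of l] by (simp add: mult_ac)
      then show ?thesis
        using plus True by (simp add: C_def)
    next
      case False
      have "C (int k - int l) = (1 - cos (of_int (int k - int l) * pi)) / 2"
        unfolding C_def by (rule sum_cos_multiples) (use assms False in auto)
      moreover have "cos (of_int (int k - int l) * pi) = cos (of_int (int k + int l) * pi)"
        by (simp add: algebra_simps cos_add cos_diff)
      ultimately show ?thesis
        using plus False by simp
    qed
  qed
  finally show ?thesis .
qed

text \<open>By orthogonality the transposed mode matrix times the mode matrix is a nonzero multiple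
  of the identity.\<close>

lemma grid_mode_det_nonzero: "leibniz_det (grid_verts m n) (grid_mode m n) \<noteq> 0"
proof -
  let ?V = "grid_verts m n"
  let ?c = "real (m + 1) / 2 * (real (n + 1) / 2)"
  have fin: "finite ?V"
    by (simp add: grid_verts_def)
  have orth: "(\<Sum>w\<in>?V. grid_mode m n w k * grid_mode m n w l) = (if k = l then ?c else 0)"
    if "k \<in> ?V" "l \<in> ?V" for k l
  proof -
    have "(\<Sum>w\<in>?V. grid_mode m n w k * grid_mode m n w l) =
      (\<Sum>i\<in>{1..m}. \<Sum>j\<in>{1..n}. (sine_mode 0 m (fst k) i * sine_mode 0 m (fst l) i) *
        (sine_mode 0 n (snd k) j * sine_mode 0 n (snd l) j))"
      unfolding grid_verts_def grid_mode_def
      by (subst sum.cartesian_product) (simp add: case_prod_beta mult_ac)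
    also have "\<dots> = (\<Sum>i\<in>{1..m}. sine_mode 0 m (fst k) i * sine_mode 0 m (fst l) i) *
        (\<Sum>j\<in>{1..n}. sine_mode 0 n (snd k) j * sine_mode 0 n (snd l) j)"
      by (simp add: sum_product)
    also have "\<dots> = (if k = l then ?c else 0)"
      using that by (subst (1 2) sine_mode_orthogonal) (auto simp: grid_verts_def prod_eq_iff)
    finally show ?thesis .
  qed
  have "leibniz_det ?V (grid_mode m n) * leibniz_det ?V (grid_mode m n) =
      leibniz_det ?V (\<lambda>k u. grid_mode m n u k) * leibniz_det ?V (grid_mode m n)"
    by (simp only: leibniz_det_transpose[OF fin, of "grid_mode m n"])
  also have "\<dots> = leibniz_det ?V (\<lambda>k l. \<Sum>w\<in>?V. grid_mode m n w k * grid_mode m n w l)"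
    by (rule leibniz_det_mult[OF fin, symmetric])
  also have "\<dots> = leibniz_det ?V (\<lambda>k l. if k = l then ?c else 0)"
    using orth by (intro leibniz_det_cong)
  also have "\<dots> = (\<Prod>v\<in>?V. ?c)"
    by (rule leibniz_det_diag[OF fin])
  also have "\<dots> \<noteq> 0"
    by simp
  finally show ?thesis
    by auto
qed

text \<open>Determinants are taken in \<open>K K^T Q = Q D\<close>, with \<open>Q\<close> the mode
  matrix and \<open>D\<close> the diagonal matrix of \<open>grid_eig\<close>, and
  \<open>det Q\<close> is cancelled.\<close>

theorem kasteleyn_det_sq:
  "(leibniz_det (grid_verts m n) (kasteleyn a b z))\<^sup>2 = (\<Prod>k\<in>grid_verts m n. grid_eig m n a b z k)"
proof -
  let ?V = "grid_verts m n"
  let ?D = "leibniz_det ?V (kasteleyn a b z)"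
  let ?Q = "leibniz_det ?V (grid_mode m n)"
  have fin: "finite ?V"
    by (simp add: grid_verts_def)
  have tr: "leibniz_det ?V (kasteleyn (- a) (- b) z) = ?D"
  proof -
    have "kasteleyn (- a) (- b) z = (\<lambda>u v. kasteleyn a b z v u)"
      by (intro ext kasteleyn_transpose)
    then show ?thesis
      by (simp only: leibniz_det_transpose[OF fin, of "kasteleyn a b z"])
  qed
  have "?D * (leibniz_det ?V (kasteleyn (- a) (- b) z) * ?Q) =
    leibniz_det ?V (\<lambda>u k. \<Sum>w\<in>?V. kasteleyn a b z u w *
      (\<Sum>v\<in>?V. kasteleyn (- a) (- b) z w v * grid_mode m n v k))"
    by (simp only: leibniz_det_mult[OF fin])
  also have "\<dots> = leibniz_det ?V (\<lambda>u k. grid_eig m n a b z k * grid_mode m n u k)"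
    by (intro leibniz_det_cong kasteleyn_kasteleyn_transpose_mode)
  also have "\<dots> = leibniz_det ?V (\<lambda>u k. \<Sum>w\<in>?V. grid_mode m n u w * (if w =
    k then grid_eig m n a b z k else 0))"
  proof (rule leibniz_det_cong)
    fix u k assume "k \<in> ?V"
    have "(\<Sum>w\<in>?V. grid_mode m n u w * (if w = k then grid_eig m n a b z k else 0)) =
        (\<Sum>w\<in>?V. if w = k then grid_mode m n u w * grid_eig m n a b z k else 0)"
      by (intro sum.cong) auto
    then show "grid_eig m n a b z k * grid_mode m n u k =
        (\<Sum>w\<in>?V. grid_mode m n u w * (if w = k then grid_eig m n a b z k else 0))"
      using fin \<open>k \<in> ?V\<close> by (simp add: sum.delta mult.commute)
  qed
  also have "\<dots> = ?Q * leibniz_det ?V (\<lambda>w k. if w = k then grid_eig m n a b z k else 0)"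
    by (rule leibniz_det_mult[OF fin])
  also have "leibniz_det ?V (\<lambda>w k. if w = k then grid_eig m n a b z k else 0) =
      (\<Prod>k\<in>?V. grid_eig m n a b z k)"
    by (rule leibniz_det_diag[OF fin])
  finally show ?thesis
    unfolding tr using grid_mode_det_nonzero[of m n] by (simp add: power2_eq_square
      mult.commute[of _ ?Q])
qed

lemma grid_eig_pos: "z > 0 \<Longrightarrow> grid_eig m n a b z k > 0"
  unfolding grid_eig_def by (intro add_pos_nonneg) simp_all

text \<open>Scaling the edge weights by \<open>t\<close> from 1 down to 0 deforms the matrix into
  \<open>z\<close> times the identity. The square of the determinant stays positive on the way, so
  its sign cannot change.\<close>

theorem kasteleyn_det_pos:
  assumes "z > 0"
  shows "leibniz_det (grid_verts m n) (kasteleyn a b z) > 0"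
proof (rule ccontr)
  let ?V = "grid_verts m n"
  let ?D = "\<lambda>t. leibniz_det ?V (kasteleyn (t * a) (t * b) z)"
  assume "\<not> leibniz_det ?V (kasteleyn a b z) > 0"
  then have "?D 1 \<le> 0"
    by simp
  moreover have "?D 0 = z ^ card ?V"
  proof -
    have "?D 0 = leibniz_det ?V (\<lambda>u v. if u = v then z else 0)"
      by (rule leibniz_det_cong) (auto simp: kasteleyn_def)
    then show ?thesis
      by (simp add: leibniz_det_diag grid_verts_def)
  qed
  then have "0 \<le> ?D 0"
    using assms by simp
  moreover have "continuous_on {0..1} ?D"
    unfolding leibniz_det_def kasteleyn_def by (intro continuous_intros)
  ultimately obtain t where "?D t = 0"
    using IVT2'[of ?D 1 0 0] by auto
  then have "(\<Prod>k\<in>?V. grid_eig m n (t * a) (t * b) z k) = 0"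
    using kasteleyn_det_sq[of m n "t * a" "t * b" z] by simp
  moreover have "(\<Prod>k\<in>?V. grid_eig m n (t * a) (t * b) z k) > 0"
    using grid_eig_pos[OF assms] by (intro prod_pos) auto
  ultimately show False
    by simp
qed

section \<open>The partition function as a determinant\<close>

lemma grid_edge_cases:
  assumes "{u, v} \<in> a_edges m n \<union> b_edges m n"
  obtains (N) "v = (fst u, snd u + 1)" "{u, v} \<in> a_edges m n" "u \<in> grid_verts m n" "v \<in> grid_verts
    m n"
  | (S) "u = (fst v, snd v + 1)" "{u, v} \<in> a_edges m n" "u \<in> grid_verts m n" "v \<in> grid_verts m n"
  | (E) "v = (fst u + 1, snd u)" "{u, v} \<notin> a_edges m n" "u \<in> grid_verts m n" "v \<in> grid_verts m n"
  | (W) "u = (fst v + 1, snd v)" "{u, v} \<notin> a_edges m n" "u \<in> grid_verts m n" "v \<in> grid_verts m n"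
proof -
  have not_a: "{(i, j), (i + 1, j)} \<notin> a_edges m n" for i j
    by (auto simp: a_edges_def doubleton_eq_iff)
  from assms show ?thesis
  proof
    assume a: "{u, v} \<in> a_edges m n"
    then obtain i j where ij: "{u, v} = {(i, j), (i, j + 1)}" "(i, j) \<in> grid_verts m n" "(i, j +
      1) \<in> grid_verts m n"
      unfolding a_edges_def by blast
    then consider "u = (i, j)" "v = (i, j + 1)" | "v = (i, j)" "u = (i, j + 1)"
      unfolding doubleton_eq_iff by blast
    then show ?thesis
      by cases (use N S a ij in auto)
  next
    assume b: "{u, v} \<in> b_edges m n"
    then obtain i j where ij: "{u, v} = {(i, j), (i + 1, j)}" "(i, j) \<in> grid_verts m n" "(i + 1,
      j) \<in> grid_verts m n"
      unfolding b_edges_def by blast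
    have na: "{u, v} \<notin> a_edges m n"
      unfolding ij(1) by (rule not_a)
    from ij consider "u = (i, j)" "v = (i + 1, j)" | "v = (i, j)" "u = (i + 1, j)"
      unfolding doubleton_eq_iff by blast
    then show ?thesis
      by cases (use E W na ij in auto)
  qed
qed

text \<open>Factored to match \<open>east_sign\<close>, \<open>south_sign\<close> and
  \<open>vertical_sign\<close> termwise.\<close>

definition arc_sign :: "nat \<times> nat \<Rightarrow> nat \<times> nat \<Rightarrow> int" where
  "arc_sign u v = (if fst v = fst u + 1 then -1 else 1) * (if snd u = snd v + 1 then -1 else 1) *
     (if fst v = fst u \<and> odd (fst u) then -1 else 1)"

abbreviation grid_weight :: "nat \<Rightarrow> nat \<Rightarrow> real \<Rightarrow> real \<Rightarrow> (nat \<times> nat) set \<Rightarrow> real" where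
  "grid_weight m n a b \<equiv> (\<lambda>e. if e \<in> a_edges m n then a else b)"

lemma kasteleyn_arc:
  assumes "{u, v} \<in> a_edges m n \<union> b_edges m n"
  shows "kasteleyn a b z u v = of_int (arc_sign u v) * grid_weight m n a b {u, v}"
  using assms
proof (cases rule: grid_edge_cases)
  case N
  then obtain i j where "u = (i, j)" "v = (i, j + 1)"
    by (cases u) auto
  then show ?thesis
    using N(2) by (simp add: kasteleyn_def arc_sign_def)
next
  case S
  then obtain i j where "v = (i, j)" "u = (i, j + 1)"
    by (cases v) auto
  then show ?thesis
    using S(2) by (simp add: kasteleyn_def arc_sign_def)
next
  case E
  then obtain i j where "u = (i, j)" "v = (i + 1, j)"
    by (cases u) auto
  then show ?thesis
    using E(2) by (simp add: kasteleyn_def arc_sign_def)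
next
  case W
  then obtain i j where "v = (i, j)" "u = (i + 1, j)"
    by (cases v) auto
  then show ?thesis
    using W(2) by (simp add: kasteleyn_def arc_sign_def)
qed

text \<open>For a doubled edge, which encloses nothing, this is the required sign
  \<open>-(-1)^0\<close>.\<close>

lemma arc_sign_swap:
  assumes "{u, v} \<in> a_edges m n \<union> b_edges m n"
  shows "arc_sign u v * arc_sign v u = -1"
  using assms
  by (cases rule: grid_edge_cases) (auto simp: arc_sign_def)

lemma lexicographic_min_exists:
  fixes f g :: "nat \<Rightarrow> nat"
  assumes "0 < (N :: nat)"
  obtains k where "k < N" "\<And>l. l < N \<Longrightarrow> g k < g l \<or> g k = g l \<and> f k \<le> f l"
proof -
  let ?Y = "Min (g ` {..<N})"
  let ?A = "{k. k < N \<and> g k = ?Y}"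
  have "?Y \<in> g ` {..<N}"
    using assms by (intro Min_in) auto
  then have A: "finite ?A" "?A \<noteq> {}"
    by auto
  then have "Min (f ` ?A) \<in> f ` ?A"
    by (intro Min_in) auto
  then obtain k where k: "k \<in> ?A" "f k = Min (f ` ?A)"
    by auto
  have "g k < g l \<or> g k = g l \<and> f k \<le> f l" if l: "l < N" for l
  proof (cases "g l = ?Y")
    case True
    then have "f k \<le> f l"
      unfolding k(2) using A(1) l by (intro Min_le) auto
    then show ?thesis
      using True k(1) by simp
  next
    case False
    moreover have "?Y \<le> g l"
      using l by (intro Min_le) auto
    ultimately show ?thesis
      using k(1) by simp
  qed
  then show ?thesis
    using that k(1) by blast
qed

lemma grid_loop_sign:
  assumes vs: "distinct vs" "4 \<le> length vs" "even (length vs)"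
    and E: "\<And>u v. (u, v) \<in> set (zip vs (rotate1 vs)) \<Longrightarrow> {u, v} \<in> a_edges m n \<union> b_edges m n"
  shows "(\<Prod>(u, v)\<in>set (zip vs (rotate1 vs)). arc_sign u v) =
    - ((-1) ^ card (enclosed_verts (grid_verts m n) grid_pos (set (zip vs (rotate1 vs)))))"
proof -
  define N where "N = length vs"
  define L where "L = set (zip vs (rotate1 vs))"
  have N: "4 \<le> N" "0 < N" "even N"
    using vs by (auto simp: N_def)
  obtain k0 where k0: "k0 < N"
    "\<And>l. l < N \<Longrightarrow> snd (vs ! k0) < snd (vs ! l) \<or> snd (vs ! k0) = snd (vs ! l) \<and> fst (vs ! k0) \<le>
      fst (vs ! l)"
    using lexicographic_min_exists[OF N(2), of "\<lambda>k. snd (vs ! k)" "\<lambda>k. fst (vs ! k)"] by blast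
  \<comment> \<open>The loop is rotated to start at the leftmost of its lowest vertices, as Hopf's
    argument demands, and continued periodically.\<close>
  define w where "w k = vs ! ((k + k0) mod N)" for k
  define x y where "x k = int (fst (w k))" and "y k = int (snd (w k))" for k
  have L: "L = (\<lambda>i. (vs ! i, vs ! (Suc i mod N))) ` {..<N}"
    unfolding L_def N_def by (rule zip_rotate1_conv_nth)
  have w_eq: "w i = w j \<longleftrightarrow> i mod N = j mod N" for i j
  proof -
    have "w i = w j \<longleftrightarrow> (i + k0) mod N = (j + k0) mod N"
      unfolding w_def using N by (intro nth_eq_iff_index_eq[OF vs(1)]) (simp_all add: N_def)
    also have "\<dots> \<longleftrightarrow> i mod N = j mod N"
      using cong_add_rcancel_nat[of i k0 j N] by (simp add: cong_def)
    finally show ?thesis .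
  qed
  have arc_in: "(w k, w (Suc k)) \<in> L" for k
    unfolding L using N by (intro image_eqI[of _ _ "(k + k0) mod N"]) (simp_all add: w_def
      mod_Suc_eq)
  have L_range: "L = (\<lambda>k. (w k, w (Suc k))) ` {..<N}"
  proof
    show "L \<subseteq> (\<lambda>k. (w k, w (Suc k))) ` {..<N}"
    proof
      fix e assume "e \<in> L"
      then obtain i where i: "i < N" "e = (vs ! i, vs ! (Suc i mod N))"
        unfolding L by blast
      define k where "k = (i + (N - k0)) mod N"
      have "(k + k0) mod N = (i + (N - k0) + k0) mod N"
        unfolding k_def by (rule mod_add_left_eq)
      also have "i + (N - k0) + k0 = i + N"
        using k0(1) by simp
      also have "(i + N) mod N = i"
        using i(1) by simp
      finally have k: "(k + k0) mod N = i" .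
      then have "(Suc k + k0) mod N = Suc i mod N"
        by (metis add_Suc mod_Suc_eq)
      then have "e = (w k, w (Suc k))"
        using i(2) k by (simp only: w_def)
      moreover have "k < N"
        using N by (simp add: k_def)
      ultimately show "e \<in> (\<lambda>k. (w k, w (Suc k))) ` {..<N}"
        by blast
    qed
  qed (use arc_in in auto)
  have edge: "{w k, w (Suc k)} \<in> a_edges m n \<union> b_edges m n" for k
    using E arc_in[of k] by (simp only: L_def)
  have step: "unit_step (x (Suc k) - x k) (y (Suc k) - y k)" for k
    using edge[of k] by (cases rule: grid_edge_cases) (auto simp: x_def y_def unit_step_def)
  interpret lattice_cycle x y N
  proof
    show "3 \<le> N"
      using N by simp
    show "(x i, y i) = (x j, y j) \<longleftrightarrow> i mod N = j mod N" for i j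
      using w_eq[of i j] by (auto simp: x_def y_def prod_eq_iff)
  qed (rule step)
  have wV: "w k \<in> grid_verts m n" for k
    using edge[of k] by (cases rule: grid_edge_cases) auto
  have pos: "grid_pos p = lattice_point (int (fst p), int (snd p))" for p
    by (simp add: grid_pos_def lattice_point_def)
  have pos_w: "grid_pos (w k) = lattice_point (vertex k)" for k
    by (simp add: pos vertex_def x_def y_def)
  have inj: "inj_on (\<lambda>k. (w k, w (Suc k))) {..<N}"
    by (auto simp: inj_on_def w_eq)
  have "(\<Prod>(u, v)\<in>L. arc_sign u v) = (\<Prod>k<N. arc_sign (w k) (w (Suc k)))"
    unfolding L_range by (subst prod.reindex[OF inj]) simp
  also have "\<dots> = (\<Prod>k<N. east_sign k * south_sign k * vertical_sign k)"
  proof (intro prod.cong refl)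
    fix k
    show "arc_sign (w k) (w (Suc k)) = east_sign k * south_sign k * vertical_sign k"
      by (simp add: arc_sign_def east_sign_def south_sign_def vertical_sign_def x_def y_def)
  qed
  also have "\<dots> = - ((-1) ^ card {p \<in> {1..m} \<times> {1..n}. lattice_point (int (fst p),
    int (snd p)) \<in> inside curve})"
  proof (rule kasteleyn_sign_inside)
    show "even N"
      using N by simp
    show "y 0 < y k \<or> y 0 = y k \<and> x 0 \<le> x k" for k
      using k0(1) k0(2)[of "(k + k0) mod N"] N by (simp add: x_def y_def w_def)
    show "1 \<le> x k \<and> x k \<le> int m \<and> 1 \<le> y k \<and> y k \<le> int n" for k
      using wV[of k] by (auto simp: grid_verts_def x_def y_def)
  qed
  also have "{p \<in> {1..m} \<times> {1..n}. lattice_point (int (fst p), int (snd p)) \<in> inside curve} =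
      enclosed_verts (grid_verts m n) grid_pos L"
  proof -
    have "loop_curve grid_pos L = curve"
      by (simp add: loop_curve_def L_range curve_def pos_w)
    then show ?thesis
      by (simp add: enclosed_verts_def grid_verts_def pos)
  qed
  finally show ?thesis
    by (simp only: L_def)
qed

lemma grid_loop_weight:
  assumes "directed_loop (a_edges m n \<union> b_edges m n) L"
  shows "loop_weight (grid_verts m n) grid_pos (grid_weight m n a b) L = - (\<Prod>(u,
    v)\<in>L. kasteleyn a b z u v)"
proof -
  obtain vs where vs: "distinct vs" "2 \<le> length vs" "even (length vs)" "L =
    set (zip vs (rotate1 vs))"
    and E: "\<And>u v. (u, v) \<in> L \<Longrightarrow> {u, v} \<in> a_edges m n \<union> b_edges m n"
    using assms unfolding directed_loop_def by blast
  have sign: "(\<Prod>(u, v)\<in>L. arc_sign u v) = - ((-1) ^ card (enclosed_verts (grid_verts m n) grid_pos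
    L))"
  proof (cases "length vs = 2")
    case True
    then obtain u v where uv: "vs = [u, v]"
      by (auto simp: length_Suc_conv numeral_2_eq_2)
    then have L: "L = {(u, v), (v, u)}" and ne: "u \<noteq> v"
      using vs by auto
    have "loop_curve grid_pos L = closed_segment (grid_pos u) (grid_pos v)"
      by (simp add: loop_curve_def L closed_segment_commute)
    then have "enclosed_verts (grid_verts m n) grid_pos L = {}"
      by (simp add: enclosed_verts_def inside_convex)
    then show ?thesis
      using arc_sign_swap[OF E[of u v]] ne by (simp add: L)
  next
    case False
    then have "4 \<le> length vs"
      using vs(2,3) by presburger
    then show ?thesis
      using grid_loop_sign[of vs m n] vs E by blast
  qed
  have "(\<Prod>(u, v)\<in>L. kasteleyn a b z u v) = (\<Prod>(u, v)\<in>L. of_int (arc_sign u v) *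
    grid_weight m n a b {u, v})"
    using E by (intro prod.cong) (auto simp: kasteleyn_arc)
  also have "\<dots> = of_int (\<Prod>(u, v)\<in>L. arc_sign u v) * (\<Prod>(u, v)\<in>L. grid_weight m n a b {u, v})"
    by (simp add: case_prod_beta prod.distrib)
  finally show ?thesis
    unfolding sign by (simp add: loop_weight_def)
qed

theorem grid_Z_eq_det: "grid_Z m n a b z = leibniz_det (grid_verts m n) (kasteleyn a b z)"
proof -
  let ?V = "grid_verts m n" and ?E = "a_edges m n \<union> b_edges m n"
  have "grid_Z m n a b z = (\<Sum>C | md_config ?E C. (\<Prod>L\<in>C. loop_weight ?V grid_pos (grid_weight m n a
    b) L) *
      (\<Prod>v\<in>?V - (\<Union>L\<in>C. loop_verts L). kasteleyn a b z v v))"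
    by (simp add: grid_Z_def md_partition_function_def config_weight_def kasteleyn_def prod_eq_iff)
  also have "\<dots> = (\<Sum>p | p permutes ?V. of_int (sign p) * (\<Prod>v\<in>?V. kasteleyn a b z v (p v)))"
  proof (rule md_sum_eq_permutation_sum[where col = "\<lambda>v. even (fst v + snd v)"])
    show "finite ?V"
      by (simp add: grid_verts_def)
    show "\<Union>?E \<subseteq> ?V"
      by (auto simp: a_edges_def b_edges_def)
    show "even (fst u + snd u) \<noteq> even (fst v + snd v)" if "{u, v} \<in> ?E" for u v
      using that
    proof (cases rule: grid_edge_cases)
      case N
      then show ?thesis by (cases u) auto
    next
      case S
      then show ?thesis by (cases v) auto
    next
      case E
      then show ?thesis by (cases u) auto
    next
      case W
      then show ?thesis by (cases v) auto
    qed
    show "kasteleyn a b z u v = 0" if uv: "u \<in> ?V" "v \<in> ?V" "u \<noteq> v" "{u, v} \<notin> ?E" for u v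
    proof -
      have a: "{(i, j), (i, j + 1)} \<in> ?E" if "(i, j) \<in> ?V" "(i, j + 1) \<in> ?V" for i j
        using that unfolding a_edges_def by blast
      have b: "{(i, j), (i + 1, j)} \<in> ?E" if "(i, j) \<in> ?V" "(i + 1, j) \<in> ?V" for i j
        using that unfolding b_edges_def by blast
      have "v \<noteq> (fst u, snd u + 1)" "u \<noteq> (fst v, snd v + 1)" "v \<noteq> (fst u + 1,
        snd u)" "u \<noteq> (fst v + 1, snd v)"
        using uv a[of "fst u" "snd u"] a[of "fst v" "snd v"] b[of "fst u" "snd u"] b[of "fst v"
          "snd v"]
        by (metis insert_commute prod.collapse)+
      then show ?thesis
        using uv(3) by (simp add: kasteleyn_def)
    qed
    show "loop_weight ?V grid_pos (grid_weight m n a b) L = - (\<Prod>(u, v)\<in>L. kasteleyn a b z u v)"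
      if "directed_loop ?E L" for L
      using that by (rule grid_loop_weight)
  qed
  finally show ?thesis
    by (simp only: leibniz_det_def)
qed

section \<open>Means of logarithms over the grid\<close>

text \<open>The \<open>r\<close>-th moment of \<open>2 * cos t\<close> for \<open>t\<close> uniform
  on the circle.\<close>

definition central_moment :: "nat \<Rightarrow> real" where
  "central_moment r = (if even r then real (r choose (r div 2)) else 0)"

lemma two_cos_power:
  "(2 * cos x) ^ r = (\<Sum>l\<le>r. real (r choose l) * cos (of_int (2 * int l - int r) * x))"
proof -
  have "complex_of_real ((2 * cos x) ^ r) = (cis x + cis (- x)) ^ r"
    by (simp add: complex_eq_iff)
  also have "\<dots> = (\<Sum>l\<le>r. of_nat (r choose l) * cis x ^ l * cis (- x) ^ (r - l))"
    by (rule binomial_ring)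
  also have "\<dots> = (\<Sum>l\<le>r. of_real (real (r choose l)) * cis (of_int (2 * int l - int r) * x))"
  proof (intro sum.cong refl)
    fix l assume "l \<in> {..r}"
    then have "real l * x + real (r - l) * - x = of_int (2 * int l - int r) * x"
      by (simp add: of_nat_diff algebra_simps)
    then have "cis x ^ l * cis (- x) ^ (r - l) = cis (of_int (2 * int l - int r) * x)"
      unfolding Complex.DeMoivre cis_mult by (rule arg_cong)
    then show "of_nat (r choose l) * cis x ^ l * cis (- x) ^ (r - l) =
        of_real (real (r choose l)) * cis (of_int (2 * int l - int r) * x)"
      by (simp add: mult.assoc)
  qed
  finally have "Re (complex_of_real ((2 * cos x) ^ r)) =
      Re (\<Sum>l\<le>r. of_real (real (r choose l)) * cis (of_int (2 * int l - int r) * x))"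
    by (rule arg_cong)
  moreover have "Re (of_real a * cis t) = a * cos t" for a t
    by simp
  ultimately show ?thesis
    by (simp only: Re_complex_of_real Re_sum)
qed

text \<open>These are twice the real parts of the \<open>(m + 1)\<close>-th roots of unity. Doubling
  the angle makes the square of \<open>mode_eig\<close> equal to 2 plus this, and the 2 from each
  direction yields the 4 in \<open>4 + z^2\<close>.\<close>

definition circle_point :: "nat \<Rightarrow> nat \<Rightarrow> real" where
  "circle_point m k = 2 * cos (real k * (2 * pi / real (m + 1)))"

lemma mode_eig_sq: "(mode_eig m k)\<^sup>2 = 2 + circle_point m k"
proof -
  let ?t = "pi * real k / real (m + 1)"
  have "cos (real k * (2 * pi / real (m + 1))) = cos (2 * ?t)"
    by (rule arg_cong[of _ _ cos]) (simp add: field_simps)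
  also have "\<dots> = 2 * (cos ?t)\<^sup>2 - 1"
    by (rule cos_double_cos)
  finally show ?thesis
    by (simp only: mode_eig_def circle_point_def power_mult_distrib) simp
qed

text \<open>Only frequency 0 survives: the frequencies \<open>2 * l - r\<close> have modulus at most
  \<open>r < m + 1\<close>, so no other one is a multiple of \<open>m + 1\<close>.\<close>

lemma sum_circle_power:
  assumes "r \<le> m"
  shows "(\<Sum>k<m + 1. circle_point m k ^ r) = real (m + 1) * central_moment r"
proof -
  have inner: "(\<Sum>k<m + 1. cos (of_int (2 * int l - int r) * (real k * (2 * pi / real (m + 1))))) =
      (if 2 * l = r then real (m + 1) else 0)" if "l \<le> r" for l
  proof -
    have "(\<Sum>k<m + 1. cos (of_int (2 * int l - int r) * (real k * (2 * pi / real (m + 1))))) =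
        (\<Sum>k<m + 1. cos (real k * (pi * of_int (2 * (2 * int l - int r)) / real (m + 1))))"
      by (intro sum.cong refl arg_cong[of _ _ cos]) (simp add: field_simps)
    also have "\<dots> = (if 2 * l = r then real (m + 1) else 0)"
    proof (cases "2 * l = r")
      case True
      then have *: "2 * int l - int r = 0"
        by simp
      show ?thesis
        unfolding * using True by simp
    next
      case False
      have "cos (of_int (2 * (2 * int l - int r)) * pi) = 1"
        using cos_int_2pin[of "2 * int l - int r"] by (simp add: mult_ac)
      then show ?thesis
        using False that assms by (subst sum_cos_multiples) (auto simp: abs_if)
    qed
    finally show ?thesis .
  qed
  have "(\<Sum>k<m + 1. circle_point m k ^ r) = (\<Sum>k<m + 1. \<Sum>l\<le>r. real (r choose l) *
      cos (of_int (2 * int l - int r) * (real k * (2 * pi / real (m + 1)))))"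
    unfolding circle_point_def two_cos_power ..
  also have "\<dots> = (\<Sum>l\<le>r. real (r choose l) *
      (\<Sum>k<m + 1. cos (of_int (2 * int l - int r) * (real k * (2 * pi / real (m + 1))))))"
    by (subst sum.swap) (simp only: sum_distrib_left)
  also have "\<dots> = (\<Sum>l\<le>r. real (r choose l) * (if 2 * l = r then real (m + 1) else 0))"
    by (intro sum.cong refl) (simp only: inner atMost_iff)
  also have "\<dots> = real (m + 1) * central_moment r"
  proof (cases "even r")
    case True
    then obtain s where s: "r = 2 * s" by blast
    have "(\<Sum>l\<le>r. real (r choose l) * (if 2 * l = r then real (m + 1) else 0)) =
        (\<Sum>l\<le>r. if l = s then real (r choose l) * real (m + 1) else 0)"
      by (intro sum.cong) (auto simp: s)
    then show ?thesis
      using s by (simp add: sum.delta central_moment_def)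
  next
    case False
    then have "2 * l \<noteq> r" for l
      by auto
    then show ?thesis
      using False by (simp add: central_moment_def)
  qed
  finally show ?thesis .
qed

definition empirical_moment :: "nat \<Rightarrow> nat \<Rightarrow> real" where
  "empirical_moment r m = (\<Sum>k\<in>{1..m}. circle_point m k ^ r) / real m"

lemma empirical_moment_tendsto: "empirical_moment r \<longlonglongrightarrow> central_moment r"
proof -
  \<comment> \<open>The points \<open>1..m\<close> are the full circle without \<open>k = 0\<close>,
    whose \<open>r\<close>-th power is \<open>2 ^ r\<close>.\<close>
  have "eventually (\<lambda>m. (real (m + 1) * central_moment r - 2 ^ r) / real m =
    empirical_moment r m) at_top"
    using eventually_ge_at_top[of r]
  proof eventually_elim
    case (elim m)
    have "(\<Sum>k<m + 1. circle_point m k ^ r) = circle_point m 0 ^ r +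
      (\<Sum>k\<in>{1..m}. circle_point m k ^ r)"
      by (simp only: lessThan_Suc_atMost Suc_eq_plus1[symmetric] atMost_atLeast0)
         (simp add: sum.atLeast_Suc_atMost)
    then show ?case
      using sum_circle_power[OF elim] by (simp add: empirical_moment_def circle_point_def)
  qed
  moreover have "(\<lambda>m. (real (m + 1) * central_moment r - 2 ^ r) / real m) \<longlonglongrightarrow> central_moment r"
  proof -
    have "((\<lambda>m. (real (m + 1) * c - d) / real m) \<longlongrightarrow> c) at_top" for c d :: real
      by real_asymp
    then show ?thesis .
  qed
  ultimately show ?thesis
    by (rule Lim_transform_eventually[rotated])
qed

text \<open>Both sides count closed walks of length \<open>r\<close> in the square lattice, the left
  one by the number of horizontal steps. The proof uses
  \<open>C(2s,2j) C(2j,j) C(2s-2j,s-j) = C(2s,s) C(s,j)^2\<close> and the sum of squared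
  binomials.\<close>

lemma sum_central_moments:
  "(\<Sum>l\<le>r. real (r choose l) * (central_moment l * central_moment (r - l))) =
     (if even r then (real (r choose (r div 2)))\<^sup>2 else 0)"
proof (cases "even r")
  case False
  have "central_moment l * central_moment (r - l) = 0" if "l \<le> r" for l
    using that False by (auto simp: central_moment_def)
  then have "(\<Sum>l\<le>r. real (r choose l) * (central_moment l * central_moment (r - l))) = 0"
    by (intro sum.neutral ballI) simp
  then show ?thesis
    using False by simp
next
  case True
  then obtain s where s: "r = 2 * s" by blast
  let ?f = "\<lambda>l. real (r choose l) * (central_moment l * central_moment (r - l))"
  have "(\<Sum>l\<le>r. ?f l) = (\<Sum>l\<in>(\<lambda>j. 2 * j) ` {..s}. ?f l)"
  proof (rule sum.mono_neutral_right)
    show "\<forall>l\<in>{..r} - (\<lambda>j. 2 * j) ` {..s}. ?f l = 0"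
    proof
      fix l assume l: "l \<in> {..r} - (\<lambda>j. 2 * j) ` {..s}"
      have "odd l"
      proof
        assume "even l"
        then obtain j where "l = 2 * j" by blast
        then show False
          using l s by auto
      qed
      then show "?f l = 0"
        by (simp add: central_moment_def)
    qed
  qed (auto simp: s)
  also have "\<dots> = (\<Sum>j\<le>s. ?f (2 * j))"
    by (subst sum.reindex) (auto simp: inj_on_def)
  also have "\<dots> = (\<Sum>j\<le>s. real (r choose s) * real ((s choose j)\<^sup>2))"
  proof (intro sum.cong refl)
    fix j assume "j \<in> {..s}"
    then have j: "j \<le> s" by simp
    have "r - 2 * j = 2 * (s - j)"
      by (simp add: s)
    then have "?f (2 * j) = real (2 * s choose (2 * j)) * (real (2 * j choose j) * real (2 *
      (s - j) choose (s - j)))"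
      by (simp add: central_moment_def s)
    also have "\<dots> = (fact (2 * s) / (fact (2 * j) * fact (2 * (s - j)))) *
        ((fact (2 * j) / (fact j * fact j)) * (fact (2 * (s - j)) / (fact (s - j) * fact (s - j))))"
    proof -
      have "2 * s - 2 * j = 2 * (s - j)" "2 * j - j = j" "2 * (s - j) - (s - j) = s - j"
        using j by simp_all
      then show ?thesis
        using j by (simp add: binomial_fact)
    qed
    also have "\<dots> = (fact (2 * s) / (fact s * fact s)) * (fact s / (fact j * fact (s - j)))\<^sup>2"
      by (simp add: field_simps power2_eq_square)
    also have "\<dots> = real (r choose s) * real ((s choose j)\<^sup>2)"
      using j by (simp add: binomial_fact s)
    finally show "?f (2 * j) = real (r choose s) * real ((s choose j)\<^sup>2)" .
  qed
  also have "\<dots> = real (r choose s) * real (\<Sum>j\<le>s. (s choose j)\<^sup>2)"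
    by (simp add: sum_distrib_left)
  also have "\<dots> = (real (r choose s))\<^sup>2"
    unfolding choose_square_sum by (simp add: s power2_eq_square)
  finally show ?thesis
    using True by (simp add: s)
qed

text \<open>\<open>log_coeff c 0 = 0\<close>, by division by zero, as the series of \<open>ln (c + t) - ln c\<close> requires.\<close>

definition log_coeff :: "real \<Rightarrow> nat \<Rightarrow> real" where
  "log_coeff c r = - ((- 1) ^ r / (of_nat r * c ^ r))"

text \<open>Built from one-dimensional moments, so that the joint limit is a finite sum of products
  of separate limits; \<open>pair_moment_eq\<close> shows that it is the mean of the
  \<open>r\<close>-th powers.\<close>

definition pair_moment :: "nat \<Rightarrow> nat \<times> nat \<Rightarrow> real" where
  "pair_moment r p = (\<Sum>l\<le>r. real (r choose l) * (empirical_moment l (fst p) *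
    empirical_moment (r - l) (snd p)))"

lemma pair_moment_eq:
  "pair_moment r (m, n) =
    (\<Sum>k\<in>grid_verts m n. (circle_point m (fst k) + circle_point n (snd k)) ^ r) / (real m * real n)"
proof -
  have "(\<Sum>k\<in>grid_verts m n. (circle_point m (fst k) + circle_point n (snd k)) ^ r) =
      (\<Sum>i\<in>{1..m}. \<Sum>j\<in>{1..n}. \<Sum>l\<le>r. real (r choose l) * (circle_point m i ^ l *
        circle_point n j ^ (r - l)))"
    unfolding grid_verts_def
    by (subst sum.cartesian_product) (simp add: case_prod_beta binomial_ring mult.assoc)
  also have "\<dots> = (\<Sum>l\<le>r. real (r choose l) * (\<Sum>i\<in>{1..m}. \<Sum>j\<in>{1..n}. circle_point m i ^ l *
    circle_point n j ^ (r - l)))"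
    unfolding sum_distrib_left
    by (subst (2) sum.swap, subst sum.swap) simp
  also have "\<dots> = (\<Sum>l\<le>r. real (r choose l) * ((\<Sum>i\<in>{1..m}. circle_point m i ^ l) *
    (\<Sum>j\<in>{1..n}. circle_point n j ^ (r - l))))"
    by (simp only: sum_product)
  finally show ?thesis
    by (simp add: pair_moment_def empirical_moment_def sum_divide_distrib[of _ "{..r}"])
qed

section \<open>The joint limit of the mean logarithm\<close>

lemma even_pairs_filterlim:
  "filterlim fst at_top even_pairs_at_top" "filterlim snd at_top even_pairs_at_top"
proof -
  have "even_pairs_at_top \<le> at_top \<times>\<^sub>F at_top"
    by (simp add: even_pairs_at_top_def)
  then show "filterlim fst at_top even_pairs_at_top" "filterlim snd at_top even_pairs_at_top"
    by (rule filterlim_mono[OF filterlim_fst order_refl], rule filterlim_mono[OF filterlim_snd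
      order_refl])
qed

lemma eventually_even_pairs: "\<forall>\<^sub>F p in even_pairs_at_top. 1 \<le> fst p \<and> 1 \<le> snd p"
  using even_pairs_filterlim by (auto simp: filterlim_at_top intro: eventually_conj)

lemma pair_moment_tendsto:
  "(pair_moment r \<longlongrightarrow> (if even r then (real (r choose (r div 2)))\<^sup>2 else 0)) even_pairs_at_top"
  unfolding pair_moment_def sum_central_moments[symmetric]
  by (intro tendsto_sum tendsto_mult tendsto_const
      filterlim_compose[OF empirical_moment_tendsto even_pairs_filterlim(1)]
      filterlim_compose[OF empirical_moment_tendsto even_pairs_filterlim(2)])

lemma circle_sum_bound: "\<bar>circle_point m i + circle_point n j\<bar> \<le> 4"
proof -
  have "\<bar>circle_point m i\<bar> \<le> 2" for m i
    by (simp add: circle_point_def abs_mult)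
  from this[of m i] this[of n j] show ?thesis
    by linarith
qed

text \<open>The two circle points have a sum of modulus at most \<open>4 < c\<close>, so the
  logarithm series converges at each grid point and can be exchanged with the finite mean.\<close>

lemma mean_log_series:
  assumes "c > 4" "1 \<le> m" "1 \<le> n"
  shows "(\<Sum>k\<in>grid_verts m n. ln (c + circle_point m (fst k) + circle_point n (snd k))) / (real m *
    real n) =
    ln c + (\<Sum>r. log_coeff c r * pair_moment r (m, n))"
proof -
  let ?V = "grid_verts m n"
  let ?t = "\<lambda>k. circle_point m (fst k) + circle_point n (snd k)"
  have sums: "(\<lambda>r. log_coeff c r * ?t k ^ r) sums (ln (c + ?t k) - ln c)" for k
  proof -
    have t: "\<bar>?t k / c\<bar> < 1"
      using circle_sum_bound[of m "fst k" n "snd k"] assms(1) by (simp add: divide_simps)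
    have "0 < 1 + ?t k / c"
      using t by linarith
    then have "ln (c * (1 + ?t k / c)) = ln c + ln (1 + ?t k / c)"
      using assms(1) by (intro ln_mult_pos) simp_all
    moreover have "c * (1 + ?t k / c) = c + ?t k"
      using assms(1) by (simp add: field_simps)
    ultimately have "ln (c + ?t k) - ln c = ln (1 + ?t k / c)"
      by simp
    moreover have "(\<lambda>r. - ((- (?t k / c)) ^ r) / of_nat r) sums ln (1 + ?t k / c)"
      by (rule ln_series'[OF t])
    moreover have "- ((- (?t k / c)) ^ r) / of_nat r = log_coeff c r * ?t k ^ r" for r
      by (simp add: log_coeff_def power_minus[of "?t k / c"] power_divide)
    ultimately show ?thesis
      by simp
  qed
  have "(\<lambda>r. (\<Sum>k\<in>?V. log_coeff c r * ?t k ^ r) / (real m * real n)) sums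
      ((\<Sum>k\<in>?V. ln (c + ?t k) - ln c) / (real m * real n))"
    by (intro sums_divide sums_sum sums)
  moreover have "(\<Sum>k\<in>?V. log_coeff c r * ?t k ^ r) / (real m * real n) = log_coeff c r *
    pair_moment r (m, n)" for r
    by (simp add: pair_moment_eq sum_distrib_left)
  moreover have "(\<Sum>k\<in>?V. ln (c + ?t k) - ln c) / (real m * real n) =
      (\<Sum>k\<in>?V. ln (c + ?t k)) / (real m * real n) - ln c"
    using assms by (simp add: sum_subtractf grid_verts_def diff_divide_distrib)
  ultimately have "(\<lambda>r. log_coeff c r * pair_moment r (m, n)) sums
      ((\<Sum>k\<in>?V. ln (c + ?t k)) / (real m * real n) - ln c)"
    by simp
  then show ?thesis
    by (simp add: sums_iff add.assoc)
qed

lemma pair_moment_bound: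
  assumes "1 \<le> m" "1 \<le> n"
  shows "\<bar>pair_moment r (m, n)\<bar> \<le> 4 ^ r"
proof -
  have "\<bar>\<Sum>k\<in>grid_verts m n. (circle_point m (fst k) + circle_point n (snd k)) ^ r\<bar> \<le>
      (\<Sum>k\<in>grid_verts m n. 4 ^ r)"
    by (rule order_trans[OF sum_abs sum_mono]) (simp add: power_abs power_mono circle_sum_bound)
  also have "\<dots> = 4 ^ r * (real m * real n)"
    by (simp add: grid_verts_def)
  finally show ?thesis
    using assms by (simp add: pair_moment_eq abs_mult divide_le_eq)
qed

text \<open>The summability is a by-product of Tannery's theorem;
  \<open>log_series_eq_hypergeo\<close> needs it to pull a constant out of the series.\<close>

theorem mean_log_tendsto:
  assumes "c > 4"
  shows "((\<lambda>(m, n). (\<Sum>k\<in>grid_verts m n. ln (c + circle_point m (fst k) + circle_point n (snd k))) /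
      (real m * real n)) \<longlongrightarrow>
    ln c + (\<Sum>r. log_coeff c r * (if even r then (real (r choose (r div 2)))\<^sup>2 else 0)))
      even_pairs_at_top"
    and "summable (\<lambda>r. log_coeff c r * (if even r then (real (r choose (r div 2)))\<^sup>2 else 0))"
proof -
  let ?b = "\<lambda>r. log_coeff c r * (if even r then (real (r choose (r div 2)))\<^sup>2 else 0)"
  have T: "(\<forall>\<^sub>F p in even_pairs_at_top. summable (\<lambda>r. norm (log_coeff c r * pair_moment r p))) \<and>
    summable (\<lambda>r. norm (?b r)) \<and>
    ((\<lambda>p. \<Sum>r. log_coeff c r * pair_moment r p) \<longlongrightarrow> suminf ?b) even_pairs_at_top"
  proof (rule tannerys_theorem)
    show "((\<lambda>p. log_coeff c r * pair_moment r p) \<longlongrightarrow> ?b r) even_pairs_at_top" for r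
      by (intro tendsto_mult tendsto_const pair_moment_tendsto)
    \<comment> \<open>The dominating series: moments are at most \<open>4 ^ r\<close> and
      coefficients at most \<open>1 / c ^ r\<close> in modulus.\<close>
    show "summable (\<lambda>r. (4 / c) ^ r)"
      using assms by (intro summable_geometric) simp
    have bound: "norm (log_coeff c r * pair_moment r p) \<le> (4 / c) ^ r"
      if p: "1 \<le> fst p \<and> 1 \<le> snd p" for r p
    proof -
      have "\<bar>log_coeff c r\<bar> \<le> 1 / c ^ r"
      proof (cases "r = 0")
        case False
        then have "1 * c ^ r \<le> real r * c ^ r"
          using assms by (intro mult_right_mono) auto
        then show ?thesis
          using assms False by (simp add: log_coeff_def abs_mult power_abs frac_le)
      qed (simp add: log_coeff_def)
      moreover have "\<bar>pair_moment r p\<bar> \<le> 4 ^ r"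
        using pair_moment_bound[of "fst p" "snd p" r] p by simp
      ultimately have "\<bar>log_coeff c r\<bar> * \<bar>pair_moment r p\<bar> \<le> 1 / c ^ r * 4 ^ r"
        using assms by (intro mult_mono) auto
      then show ?thesis
        by (simp add: abs_mult power_divide)
    qed
    have "\<forall>\<^sub>F q in at_top \<times>\<^sub>F even_pairs_at_top. 1 \<le> fst (snd q) \<and> 1 \<le> snd (snd q)"
      using filterlim_snd eventually_even_pairs by (rule eventually_compose_filterlim[rotated])
    then show "\<forall>\<^sub>F (r, p) in at_top \<times>\<^sub>F even_pairs_at_top.
        norm (log_coeff c r * pair_moment r p) \<le> (4 / c) ^ r"
      by eventually_elim (use bound in auto)
    show "even_pairs_at_top \<noteq> bot"
      by (rule even_pairs_at_top_neq_bot)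
  qed
  show "summable ?b"
    by (rule summable_norm_cancel) (rule T[THEN conjunct2, THEN conjunct1])
  have "((\<lambda>p. ln c + (\<Sum>r. log_coeff c r * pair_moment r p)) \<longlongrightarrow> ln c + suminf ?b) even_pairs_at_top"
    by (intro tendsto_add tendsto_const T[THEN conjunct2, THEN conjunct2])
  moreover have "\<forall>\<^sub>F p in even_pairs_at_top. ln c + (\<Sum>r. log_coeff c r * pair_moment r p) =
      (case p of (m, n) \<Rightarrow> (\<Sum>k\<in>grid_verts m n. ln (c + circle_point m (fst k) +
        circle_point n (snd k))) /
      (real m * real n))"
    using eventually_even_pairs
    by eventually_elim (auto simp: mean_log_series[OF assms])
  ultimately show "((\<lambda>(m, n). (\<Sum>k\<in>grid_verts m n. ln (c + circle_point m (fst k) +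
    circle_point n (snd k))) /
      (real m * real n)) \<longlongrightarrow> ln c + suminf ?b) even_pairs_at_top"
    by (rule Lim_transform_eventually)
qed

text \<open>Only the indices \<open>r = 2 * (i + 1)\<close> contribute. There
  \<open>(1)_i = i!\<close>, \<open>(2)_i = (i + 1)!\<close>, and \<open>(3/2)_i\<close> comes from
  the duplication formula for \<open>(2 * (i + 1))!\<close>.\<close>

lemma log_series_eq_hypergeo:
  assumes "c > 4"
  shows "(\<Sum>r. log_coeff c r * (if even r then (real (r choose (r div 2)))\<^sup>2 else 0)) =
    - 2 / c\<^sup>2 * hypergeo [1, 1, 3 / 2, 3 / 2] [2, 2, 2] (16 / c\<^sup>2)"
proof -
  let ?b = "\<lambda>r. log_coeff c r * (if even r then (real (r choose (r div 2)))\<^sup>2 else 0)"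
  let ?h = "\<lambda>i. pochhammer 1 i * pochhammer 1 i * pochhammer (3 / 2) i * pochhammer (3 / 2) i /
          (pochhammer 2 i * pochhammer 2 i * pochhammer 2 i) * ((16 / c\<^sup>2) ^ i / fact i) :: real"
  define g where "g i = 2 * (i + 1)" for i :: nat
  have mono: "strict_mono g"
    by (simp add: g_def strict_mono_def)
  have zero: "?b r = 0" if "r \<notin> range g" for r
  proof (cases "even r")
    case True
    then obtain s where s: "r = 2 * s" by blast
    have "s = 0"
      using that s by (cases s) (auto simp: g_def)
    then show ?thesis
      by (simp add: s log_coeff_def)
  qed simp
  have c0: "c \<noteq> 0"
    using assms by simp
  have coeff: "- 2 / c\<^sup>2 * ?h i = ?b (g i)" for i
  proof -
    have p1: "pochhammer 1 i = (fact i :: real)"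
      by (simp add: pochhammer_fact)
    have "pochhammer 1 (Suc i) = (1 :: real) * pochhammer (1 + 1) i"
      by (rule pochhammer_rec)
    then have p2: "pochhammer 2 i = (fact (i + 1) :: real)"
      by (simp add: pochhammer_fact[symmetric])
    have half: "pochhammer (1 / 2) (Suc i) = (1 / 2 :: real) * pochhammer (3 / 2) i"
      using pochhammer_rec[of "1 / 2 :: real" i] by simp
    have "(2 :: real) ^ (2 * Suc i) = 4 ^ Suc i"
      by (simp only: power_mult) simp
    then have double: "fact (2 * Suc i) = (4 ^ Suc i * (1 / 2 * pochhammer (3 / 2) i) *
      fact (Suc i) :: real)"
      using fact_double[of "Suc i", where ?'a = real] by (simp only: half)
    have p3: "pochhammer (3 / 2) i = (2 * fact (2 * (i + 1)) / (4 ^ (i + 1) * fact (i +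
      1)) :: real)"
      unfolding Suc_eq_plus1[symmetric] double by (simp del: fact_Suc power_Suc)
    have "g i div 2 = i + 1" "g i - (i + 1) = i + 1" "i + 1 \<le> g i" "even (g i)"
      by (simp_all add: g_def)
    note gi = this
    have choose: "real (g i choose (g i div 2)) = fact (2 * (i + 1)) / (fact (i + 1) * fact (i +
      1))"
      using binomial_fact[OF gi(3), where ?'a = real] by (simp only: gi) (simp only: g_def)
    have "log_coeff c (g i) = - (1 / (real (2 * (i + 1)) * c ^ (2 * (i + 1))))"
      by (simp add: log_coeff_def g_def)
    then have b: "?b (g i) = - (1 / (real (2 * (i + 1)) * c ^ (2 * (i + 1)))) *
        (fact (2 * (i + 1)) / (fact (i + 1) * fact (i + 1)))\<^sup>2"
      using gi(4) by (simp only: choose if_True)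
    have "(16 :: real) ^ i = (4 ^ i)\<^sup>2"
      by (simp add: power_mult[symmetric] power2_eq_square flip: power_mult_distrib)
    then have u: "(16 / c\<^sup>2) ^ i = (4 ^ i)\<^sup>2 / c ^ (2 * i)"
      by (simp add: power_divide power_mult)
    \<comment> \<open>Opaque names for the factorials and powers reduce the comparison of
      coefficients to a rational identity.\<close>
    define A B where "A = (fact (i + 1) :: real)" and "B = (fact (2 * (i + 1)) :: real)"
    define R where "R = real (i + 1)"
    define P Q where "P = (4 :: real) ^ i" and "Q = c ^ (2 * i)"
    have nz: "A \<noteq> 0" "P \<noteq> 0" "Q \<noteq> 0" "R \<noteq> 0"
      using c0 by (simp_all add: A_def P_def Q_def R_def)
    have fi: "fact i = A / R"
      by (simp add: A_def R_def)
    have fi0: "fact i \<noteq> (0 :: real)"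
      by simp
    have "- 2 / c\<^sup>2 * ?h i = - 2 / c\<^sup>2 * (fact i * fact i * (2 * B / (4 * P * A)) * (2 * B / (4 *
      P * A)) /
        (A * A * A) * (P\<^sup>2 / Q / fact i))"
      unfolding p1 p2 p3 u A_def[symmetric] B_def[symmetric] by (simp add: P_def Q_def)
    also have "\<dots> = - 2 / c\<^sup>2 * (fact i * (2 * B / (4 * P * A)) * (2 * B / (4 * P * A)) /
        (A * A * A) * (P\<^sup>2 / Q))"
      using fi0 by simp
    also have "\<dots> = - (1 / (2 * R * (c\<^sup>2 * Q))) * (B / (A * A))\<^sup>2"
      unfolding fi using nz c0 by (simp add: field_simps power2_eq_square)
    also have "\<dots> = ?b (g i)"
      unfolding b A_def[symmetric] B_def[symmetric] by (simp add: Q_def R_def power_add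
        power2_eq_square)
    finally show ?thesis .
  qed
  have "summable (\<lambda>i. - 2 / c\<^sup>2 * ?h i)"
    unfolding coeff using mean_log_tendsto(2)[OF assms] summable_mono_reindex[OF mono,
      of ?b] zero by blast
  then have "summable ?h"
    using c0 by (subst (asm) summable_cmult_iff) auto
  have "(\<Sum>r. ?b r) = (\<Sum>i. ?b (g i))"
    by (rule suminf_mono_reindex[OF mono, symmetric]) (rule zero)
  also have "\<dots> = (\<Sum>i. - 2 / c\<^sup>2 * ?h i)"
    by (simp only: coeff)
  also have "\<dots> = - 2 / c\<^sup>2 * (\<Sum>i. ?h i)"
    by (rule suminf_mult[OF \<open>summable ?h\<close>])
  finally show ?thesis
    by (simp only: hypergeo_4F3)
qed

section \<open>The free energy of the square grid\<close>

text \<open>Convergence is claimed along with the value because \<open>Lim\<close> denotes some real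
  number even where no limit exists. Passing from \<open>Z^2\<close> to \<open>Z\<close> halves both
  \<open>ln c\<close> and the factor \<open>- 2 / c^2\<close>, where
  \<open>c = 4 + z^2\<close>.\<close>

theorem mainTheorem9:
  fixes z :: real
  assumes "z > 0"
  shows "(finite_free_energy 1 1 z \<longlongrightarrow> free_energy 1 1 z) even_pairs_at_top \<and>
    free_energy 1 1 z =
      1 / 2 * ln (4 + z\<^sup>2) -
      1 / (4 + z\<^sup>2)\<^sup>2 * hypergeo [1, 1, 3 / 2, 3 / 2] [2, 2, 2] (16 / (4 + z\<^sup>2)\<^sup>2)"
proof -
  let ?c = "4 + z\<^sup>2"
  let ?H = "hypergeo [1, 1, 3 / 2, 3 / 2] [2, 2, 2] (16 / ?c\<^sup>2)"
  let ?mean = "\<lambda>(m, n). (\<Sum>k\<in>grid_verts m n. ln (?c + circle_point m (fst k) +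
    circle_point n (snd k))) /
      (real m * real n)"
  have c: "?c > 4"
    using assms by simp
  have "finite_free_energy 1 1 z (m, n) = 1 / 2 * ?mean (m, n)" for m n
  proof -
    let ?D = "grid_Z m n 1 1 z"
    have "?D > 0"
      unfolding grid_Z_eq_det by (rule kasteleyn_det_pos[OF assms])
    then have "2 * ln ?D = ln (?D\<^sup>2)"
      by (simp add: ln_realpow)
    also have "?D\<^sup>2 = (\<Prod>k\<in>grid_verts m n. grid_eig m n 1 1 z k)"
      unfolding grid_Z_eq_det by (rule kasteleyn_det_sq)
    also have "ln \<dots> = (\<Sum>k\<in>grid_verts m n. ln (grid_eig m n 1 1 z k))"
      using grid_eig_pos[OF assms, of m n 1 1] by (intro ln_prod) (auto simp: grid_verts_def
        less_imp_neq[symmetric])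
    also have "\<dots> = (\<Sum>k\<in>grid_verts m n. ln (?c + circle_point m (fst k) + circle_point n (snd k)))"
      by (simp add: grid_eig_def mode_eig_sq algebra_simps)
    finally have "ln ?D = 1 / 2 * (\<Sum>k\<in>grid_verts m n. ln (?c + circle_point m (fst k) +
      circle_point n (snd k)))"
      by simp
    then show ?thesis
      by (simp only: finite_free_energy_def prod.case) simp
  qed
  then have F: "finite_free_energy 1 1 z = (\<lambda>p. 1 / 2 * ?mean p)"
    by (simp add: fun_eq_iff)
  have "(?mean \<longlongrightarrow> ln ?c + - 2 / ?c\<^sup>2 * ?H) even_pairs_at_top"
    using mean_log_tendsto(1)[OF c] unfolding log_series_eq_hypergeo[OF c] .
  then have "(finite_free_energy 1 1 z \<longlongrightarrow> 1 / 2 * (ln ?c + - 2 / ?c\<^sup>2 * ?H)) even_pairs_at_top"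
    unfolding F by (rule tendsto_mult_left)
  moreover have "1 / 2 * (ln ?c + - 2 / ?c\<^sup>2 * ?H) = 1 / 2 * ln ?c - 1 / ?c\<^sup>2 * ?H"
    by (simp add: algebra_simps)
  ultimately have "(finite_free_energy 1 1 z \<longlongrightarrow> 1 / 2 * ln ?c - 1 / ?c\<^sup>2 * ?H) even_pairs_at_top"
    by (simp only:)
  moreover from this have "free_energy 1 1 z = 1 / 2 * ln ?c - 1 / ?c\<^sup>2 * ?H"
    unfolding free_energy_def by (rule tendsto_Lim[OF even_pairs_at_top_neq_bot])
  ultimately show ?thesis
    by simp
qed

end
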